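(* Consider the family of polynomials $\{D(B_n,x)\}_{n\ge1}$, where $B_n$ is the book graph. The set of limits of roots of this family consists of the points $x=-\tfrac12$ and $x=0$, together with the part of the circle $|x+2|=1$ with real part at least $-\tfrac32-\tfrac{\sqrt2}{2}$, the portions of the hyperbola $(\Re(x)+1)^2-(\Im(x))^2=\tfrac12$ with $\Re(x)\notin\left[\tfrac{-3-\sqrt2}{2},\tfrac{-2-\sqrt2}{2}\right]$, and the portion of the curve $|x+1|^2=|x|$ with real part at most $-\tfrac32-\tfrac{\sqrt2}{2}$.
   Context: All graphs are finite and simple. For a graph $G=(V,E)$, a set $S\subseteq V$ is dominating if every vertex of $V\setminus S$ is adjacent to a vertex of $S$. Let $d(G,i)$ be the number of dominating sets of $G$ of size $i$; the domination polynomial is $D(G,x)=\sum_{i=\gamma(G)}^{|V|} d(G,i)x^i$, where $\gamma(G)$ is the minimum size of a dominating set. The book graph $B_n$ has vertex set $\{u_1,u_2\}\cup\{v_i,w_i:1\le i\le n\}$ and edge set $\{u_1u_2\}\cup\{u_1v_i,\ u_2w_i,\ v_iw_i:1\le i\le n\}$ (i.e. $n$ copies of $C_4$ sharing the edge $u_1u_2$). It is known that $D(B_n,x)=(x^2+2x)^n(2x+1)+x^2(x+1)^{2n}-2x^n$. For a family $\{f_n(x)\}$ of complex polynomials, a number $z\in\mathbb{C}$ is a limit of roots of $\{f_n\}$ if either $f_n(z)=0$ for all sufficiently large $n$, or $z$ is a limit point of the union over $n$ of the sets of roots of $f_n$. *)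

theory Defs
  imports
    "HOL-Analysis.Analysis"
    "HOL-Computational_Algebra.Polynomial"
    "Graph_Theory.Pair_Digraph"
begin

text \<open>
  Following \<^theory>\<open>Graph_Theory.Pair_Digraph\<close>, a finite simple undirected graph is a
  symmetric loop-free finite digraph (\<^locale>\<open>pair_graph\<close>): each edge is represented by its
  two orientations.
\<close>

definition dominating_set :: "'a pair_pre_digraph \<Rightarrow> 'a set \<Rightarrow> bool" where
  "dominating_set G S \<longleftrightarrow>
     S \<subseteq> pverts G \<and> (\<forall>v \<in> pverts G - S. \<exists>s \<in> S. (v, s) \<in> parcs G)"

definition num_dominating_sets :: "'a pair_pre_digraph \<Rightarrow> nat \<Rightarrow> nat" where
  "num_dominating_sets G i = card {S. dominating_set G S \<and> card S = i}"

definition domination_number :: "'a pair_pre_digraph \<Rightarrow> nat" where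
  "domination_number G = Min (card ` {S. dominating_set G S})"

definition domination_poly :: "'a pair_pre_digraph \<Rightarrow> complex poly" where
  "domination_poly G =
     (\<Sum>i = domination_number G..card (pverts G). monom (of_nat (num_dominating_sets G i)) i)"

datatype book_vertex = U1 | U2 | V nat | W nat

definition book_edges :: "nat \<Rightarrow> book_vertex rel" where
  "book_edges n = {(U1, U2)} \<union> (\<Union>i \<in> {1..n}. {(U1, V i), (U2, W i), (V i, W i)})"

definition book_graph :: "nat \<Rightarrow> book_vertex pair_pre_digraph" where
  "book_graph n =
     \<lparr> pverts = {U1, U2} \<union> (\<Union>i \<in> {1..n}. {V i, W i}),
       parcs = book_edges n \<union> (book_edges n)\<inverse> \<rparr>"

lemma pair_graph_book_graph: "pair_graph (book_graph n)"
  by unfold_locales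
    (auto simp: book_graph_def book_edges_def symmetric_def intro!: symI)

text \<open>
  The family is indexed by \<open>n \<ge> 1\<close>; the value at index \<open>0\<close> is ignored.
\<close>

definition limit_of_roots :: "(nat \<Rightarrow> complex poly) \<Rightarrow> complex \<Rightarrow> bool" where
  "limit_of_roots f z \<longleftrightarrow>
     (\<forall>\<^sub>F n in sequentially. poly (f n) z = 0) \<or>
     z islimpt (\<Union>n \<in> {1..}. {w. poly (f n) w = 0})"

end

theory Submission
  imports Defs "HOL-Complex_Analysis.Conformal_Mappings"
begin

text \<open>
  For \<open>n \<ge> 1\<close> the domination polynomial of the book graph is
  \<open>(2x + 1)(x\<^sup>2 + 2x)\<^sup>n + x\<^sup>2((x + 1)\<^sup>2)\<^sup>n - 2x\<^sup>n\<close>, so the Beraha--Kahane--Weiss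
  dichotomy applies. Near a point where one base strictly dominates in modulus and has a nonzero
  coefficient, the dominant term wins and there are no roots for large \<open>n\<close>. Near a point where
  exactly two bases dominate with equal modulus, the equation says that the \<open>n\<close>-th power of their
  quotient equals an almost constant function; passing to a local logarithm this becomes a
  fixed-point problem, solved by Brouwer's theorem. The points with equal largest moduli are the
  three stated arcs, and those where exactly two moduli agree are dense in each arc. The isolated
  points are the zeros of the coefficients: at \<open>-1/2\<close> the first base dominates, and \<open>0\<close> is a
  common root.
\<close>

section \<open>The domination polynomial of the book graph\<close>

text \<open>Grouping dominating sets by size gives a generating function over the sets themselves,
  which can be split by structure. The lower summation bound loses nothing, being the least size
  that occurs.\<close>

lemma poly_domination_poly:
  assumes "finite (pverts G)"
  shows "poly (domination_poly G) x = (\<Sum>S | dominating_set G S. x ^ card S)"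
proof -
  let ?D = "{S. dominating_set G S}"
  have fin: "finite ?D"
    by (rule finite_subset[of _ "Pow (pverts G)"]) (auto simp: dominating_set_def assms)
  have "poly (domination_poly G) x =
      (\<Sum>i = domination_number G..card (pverts G). \<Sum>S\<in>{S\<in>?D. card S = i}. x ^ card S)"
    by (simp add: domination_poly_def poly_sum poly_monom num_dominating_sets_def)
  also have "\<dots> = (\<Sum>S\<in>?D. x ^ card S)"
  proof (rule sum.group[OF fin])
    show "card ` ?D \<subseteq> {domination_number G..card (pverts G)}"
      using fin assms
      by (auto simp: domination_number_def dominating_set_def intro!: Min_le card_mono)
  qed simp
  finally show ?thesis .
qed

text \<open>
  A selection of page vertices is recorded pagewise by the pair of truth values
  (\<open>V i\<close> selected, \<open>W i\<close> selected), which has to lie in \<open>T\<close>.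
\<close>

definition page_sets :: "(bool \<times> bool) set \<Rightarrow> nat \<Rightarrow> book_vertex set set" where
  "page_sets T n = {P. P \<subseteq> V ` {1..n} \<union> W ` {1..n} \<and> (\<forall>i\<in>{1..n}. (V i \<in> P, W i \<in> P) \<in> T)}"

text \<open>Vertex-by-vertex form, in which the induction step of \<open>sum_page_sets\<close> can
  be checked index by index.\<close>

lemma page_sets_iff:
  "P \<in> page_sets T n \<longleftrightarrow> U1 \<notin> P \<and> U2 \<notin> P \<and>
     (\<forall>i. if i \<in> {1..n} then (V i \<in> P, W i \<in> P) \<in> T else V i \<notin> P \<and> W i \<notin> P)"
proof -
  have "P \<subseteq> V ` {1..n} \<union> W ` {1..n} \<longleftrightarrow>
      (\<forall>v. v \<in> P \<longrightarrow> v \<in> V ` {1..n} \<union> W ` {1..n})"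
    by blast
  also have "\<dots> \<longleftrightarrow> U1 \<notin> P \<and> U2 \<notin> P \<and>
      (\<forall>i. i \<notin> {1..n} \<longrightarrow> V i \<notin> P \<and> W i \<notin> P)"
    by (auto, metis book_vertex.exhaust atLeastAtMost_iff image_eqI)
  finally show ?thesis
    by (auto simp: page_sets_def)
qed

lemma finite_page_sets: "finite (page_sets T n)"
  by (rule finite_subset[of _ "Pow (V ` {1..n} \<union> W ` {1..n})"]) (auto simp: page_sets_def)

lemma finite_page_set: "P \<in> page_sets T n \<Longrightarrow> finite P"
  by (rule finite_subset[of _ "V ` {1..n} \<union> W ` {1..n}"]) (auto simp: page_sets_def)

text \<open>The pages are chosen independently, so the generating function is the
  \<open>n\<close>-th power of the weight of one page.\<close>

lemma sum_page_sets:
  fixes x :: complex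
  shows "(\<Sum>P\<in>page_sets T n. x ^ card P) = (\<Sum>(a, b)\<in>T. x ^ (of_bool a + of_bool b)) ^ n"
proof (induction n)
  case 0
  have "page_sets T 0 = {{}}"
    by (auto simp: page_sets_def)
  then show ?case
    by simp
next
  case (Suc n)
  define e where "e = (\<lambda>(a, b). (if a then {V (Suc n)} else {}) \<union> (if b then {W (Suc n)} else {}))"
  have "(\<Sum>P\<in>page_sets T (Suc n). x ^ card P) =
      (\<Sum>(P, t)\<in>page_sets T n \<times> T. x ^ card P * (case t of (a, b) \<Rightarrow> x ^ (of_bool a + of_bool b)))"
  \<comment> \<open>The bijection cuts off page \<open>Suc n\<close> and records its selection
    pattern; \<open>e\<close> turns a pattern back into vertices.\<close>
  proof (rule sum.reindex_bij_witness[of _ "\<lambda>(P, t). P \<union> e t"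
        "\<lambda>P. (P - {V (Suc n), W (Suc n)}, (V (Suc n) \<in> P, W (Suc n) \<in> P))"], goal_cases)
    case (1 P)
    then show ?case
      by (auto simp: e_def)
  next
    case (2 P)
    then show ?case
      by (auto simp: page_sets_iff le_Suc_eq split: if_splits)
  next
    case (3 p)
    then show ?case
      by (auto simp: e_def page_sets_iff split: if_splits)
  next
    case (4 p)
    then show ?case
      by (auto simp: e_def page_sets_iff le_Suc_eq split: if_splits)
  next
    case (5 P)
    have "card P = card (P - {V (Suc n), W (Suc n)}) + card (P \<inter> {V (Suc n), W (Suc n)})"
      using finite_page_set[OF 5]
      by (metis Diff_Int_distrib2 Int_Diff_Un Int_Diff_disjoint card_Un_disjoint finite_Diff
          finite_Int inf_commute sup_commute)
    moreover have "card (P \<inter> {V (Suc n), W (Suc n)}) =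
        of_bool (V (Suc n) \<in> P) + of_bool (W (Suc n) \<in> P)"
      by (auto simp: Int_insert_right)
    ultimately show ?case
      by (simp add: power_add)
  qed
  also have "\<dots> = (\<Sum>P\<in>page_sets T n. x ^ card P) * (\<Sum>(a, b)\<in>T. x ^ (of_bool a + of_bool b))"
    by (simp add: sum_product sum.cartesian_product split_def)
  finally show ?case
    using Suc.IH by simp
qed

lemma sum_page_sets_Un:
  fixes x :: complex
  assumes "finite A" "A \<subseteq> {U1, U2}"
  shows "(\<Sum>S\<in>(\<union>) A ` page_sets T n. x ^ card S) =
    x ^ card A * (\<Sum>(a, b)\<in>T. x ^ (of_bool a + of_bool b)) ^ n"
proof -
  have disj: "A \<inter> P = {}" if "P \<in> page_sets T n" for P
    using that assms by (auto simp: page_sets_def)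
  have "inj_on ((\<union>) A) (page_sets T n)"
    using disj by (intro inj_onI) blast
  then have "(\<Sum>S\<in>(\<union>) A ` page_sets T n. x ^ card S) = (\<Sum>P\<in>page_sets T n. x ^ card (A \<union> P))"
    by (simp add: sum.reindex)
  also have "\<dots> = (\<Sum>P\<in>page_sets T n. x ^ card A * x ^ card P)"
    using disj assms by (intro sum.cong refl) (simp add: card_Un_disjoint finite_page_set power_add)
  finally show ?thesis
    by (simp add: sum_distrib_left[symmetric] sum_page_sets)
qed

text \<open>One selected spine vertex dominates both \<open>U1\<close> and \<open>U2\<close>;
  without any, \<open>U1\<close> relies on some \<open>V i\<close> and \<open>U2\<close> on some
  \<open>W i\<close>. The last conjunct treats the page vertices.\<close>

lemma dominating_set_book_graph_iff:
  "dominating_set (book_graph n) S \<longleftrightarrow>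
     S \<subseteq> {U1, U2} \<union> V ` {1..n} \<union> W ` {1..n} \<and>
     (U1 \<in> S \<or> U2 \<in> S \<or> (\<exists>i\<in>{1..n}. V i \<in> S) \<and> (\<exists>i\<in>{1..n}. W i \<in> S)) \<and>
     (\<forall>i\<in>{1..n}. (V i \<in> S \<or> U1 \<in> S \<or> W i \<in> S) \<and> (W i \<in> S \<or> U2 \<in> S \<or> V i \<in> S))"
  (is "?L \<longleftrightarrow> ?R")
proof -
  have arcs: "(U1, s) \<in> parcs (book_graph n) \<longleftrightarrow> s = U2 \<or> (\<exists>i\<in>{1..n}. s = V i)"
    "(U2, s) \<in> parcs (book_graph n) \<longleftrightarrow> s = U1 \<or> (\<exists>i\<in>{1..n}. s = W i)"
    "(V i, s) \<in> parcs (book_graph n) \<longleftrightarrow> i \<in> {1..n} \<and> (s = U1 \<or> s = W i)"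
    "(W i, s) \<in> parcs (book_graph n) \<longleftrightarrow> i \<in> {1..n} \<and> (s = U2 \<or> s = V i)" for s i
    by (auto simp: book_graph_def book_edges_def)
  have nbh: "(\<exists>s\<in>S. (U1, s) \<in> parcs (book_graph n)) \<longleftrightarrow> U2 \<in> S \<or> (\<exists>i\<in>{1..n}. V i \<in> S)"
    "(\<exists>s\<in>S. (U2, s) \<in> parcs (book_graph n)) \<longleftrightarrow> U1 \<in> S \<or> (\<exists>i\<in>{1..n}. W i \<in> S)"
    "(\<exists>s\<in>S. (V i, s) \<in> parcs (book_graph n)) \<longleftrightarrow> i \<in> {1..n} \<and> (U1 \<in> S \<or> W i \<in> S)"
    "(\<exists>s\<in>S. (W i, s) \<in> parcs (book_graph n)) \<longleftrightarrow> i \<in> {1..n} \<and> (U2 \<in> S \<or> V i \<in> S)" for i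
    unfolding arcs by auto
  have verts: "pverts (book_graph n) = {U1, U2} \<union> V ` {1..n} \<union> W ` {1..n}"
    by (auto simp: book_graph_def)
  have "?L \<longleftrightarrow> S \<subseteq> pverts (book_graph n) \<and>
      (\<forall>v\<in>pverts (book_graph n). v \<in> S \<or> (\<exists>s\<in>S. (v, s) \<in> parcs (book_graph n)))"
    by (auto simp: dominating_set_def)
  then show ?thesis
    unfolding verts ball_Un ball_simps nbh by auto
qed

abbreviation covered_pages :: "(bool \<times> bool) set" where
  "covered_pages \<equiv> {(True, True), (True, False), (False, True)}"

text \<open>Case split on the selected spine vertices. With both selected the pages are arbitrary;
  otherwise each page needs a selected vertex. With none selected, the all-\<open>V\<close> and
  all-\<open>W\<close> selections must also go, since they leave \<open>U2\<close> or
  \<open>U1\<close> undominated.\<close>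

lemma dominating_sets_book_graph:
  "{S. dominating_set (book_graph n) S} =
     (\<union>) {} ` (page_sets covered_pages n
       - (page_sets {(True, False)} n \<union> page_sets {(False, True)} n))
     \<union> (\<union>) {U1} ` page_sets covered_pages n \<union> (\<union>) {U2} ` page_sets covered_pages n
     \<union> (\<union>) {U1, U2} ` page_sets UNIV n"
  (is "?D = ?A \<union> ?B \<union> ?C \<union> ?E")
proof (rule set_eqI)
  fix S
  define P where "P = S - {U1, U2}"
  \<comment> \<open>Page sets avoid the spine, so \<open>S\<close> splits uniquely into its spine
    part and \<open>P\<close>; this makes the four families disjoint.\<close>
  have img: "S \<in> (\<union>) A ` X \<longleftrightarrow> S \<inter> {U1, U2} = A \<and> P \<in> X"
    if "A \<subseteq> {U1, U2}" "X \<subseteq> page_sets T n" for A X T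
  proof
    assume "S \<in> (\<union>) A ` X"
    then obtain Q where Q: "Q \<in> X" "S = A \<union> Q"
      by auto
    moreover have "Q \<inter> {U1, U2} = {}"
      using Q that by (auto simp: page_sets_def)
    ultimately have "S \<inter> {U1, U2} = A" "P = Q"
      using that by (auto simp: P_def)
    then show "S \<inter> {U1, U2} = A \<and> P \<in> X"
      using Q by simp
  next
    assume "S \<inter> {U1, U2} = A \<and> P \<in> X"
    moreover from this have "S = A \<union> P"
      by (auto simp: P_def)
    ultimately show "S \<in> (\<union>) A ` X"
      by blast
  qed
  have P: "P \<in> page_sets T n \<longleftrightarrow> S \<subseteq> {U1, U2} \<union> V ` {1..n} \<union> W ` {1..n} \<and>
      (\<forall>i\<in>{1..n}. (V i \<in> S, W i \<in> S) \<in> T)" for T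
    by (auto simp: P_def page_sets_def)
  have mem: "S \<in> ?A \<longleftrightarrow> S \<inter> {U1, U2} = {} \<and> P \<in> page_sets covered_pages n
       - (page_sets {(True, False)} n \<union> page_sets {(False, True)} n)"
    "S \<in> ?B \<longleftrightarrow> S \<inter> {U1, U2} = {U1} \<and> P \<in> page_sets covered_pages n"
    "S \<in> ?C \<longleftrightarrow> S \<inter> {U1, U2} = {U2} \<and> P \<in> page_sets covered_pages n"
    "S \<in> ?E \<longleftrightarrow> S \<inter> {U1, U2} = {U1, U2} \<and> P \<in> page_sets UNIV n"
    by (rule img; blast)+
  show "S \<in> ?D \<longleftrightarrow> S \<in> ?A \<union> ?B \<union> ?C \<union> ?E"
    unfolding Un_iff mem mem_Collect_eq dominating_set_book_graph_iff Diff_iff P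
    by (cases "U1 \<in> S"; cases "U2 \<in> S") auto
qed

text \<open>The factor \<open>2 * x + 1\<close> collects the cases of one or no spine vertex,
  \<open>x^2\<close> comes from both, and \<open>- 2 * x ^ n\<close> removes the two one-sided
  selections.\<close>

lemma poly_domination_poly_book_graph:
  assumes "n \<ge> 1"
  shows "poly (domination_poly (book_graph n)) x =
    (2 * x + 1) * (x\<^sup>2 + 2 * x) ^ n + x\<^sup>2 * ((x + 1)\<^sup>2) ^ n + (- 2) * x ^ n"
proof -
  let ?w = "\<lambda>X. \<Sum>S\<in>X. x ^ card S"
  let ?Q = "page_sets covered_pages n"
  let ?V = "page_sets {(True, False)} n" and ?W = "page_sets {(False, True)} n"
  have sub: "?V \<union> ?W \<subseteq> ?Q"
    by (fastforce simp: page_sets_def)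
  \<comment> \<open>For \<open>n = 0\<close> both families would equal \<open>{{}}\<close>; this is
    where \<open>n \<ge> 1\<close> enters.\<close>
  have disj: "?V \<inter> ?W = {}"
    using assms by (fastforce simp: page_sets_def)
  have weights: "(\<Sum>(a, b)\<in>covered_pages. x ^ (of_bool a + of_bool b)) = x\<^sup>2 + 2 * x"
    "(\<Sum>(a, b)\<in>UNIV. x ^ (of_bool a + of_bool b)) = (x + 1)\<^sup>2"
    by (simp_all add: UNIV_bool UNIV_Times_UNIV[symmetric] power2_eq_square algebra_simps
        del: UNIV_Times_UNIV)
  have "?w ((\<union>) {} ` (?Q - (?V \<union> ?W))) = ?w ?Q - ?w (?V \<union> ?W)"
    using sub by (simp add: sum_diff finite_page_sets)
  also have "\<dots> = (x\<^sup>2 + 2 * x) ^ n - 2 * x ^ n"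
    by (simp add: sum.union_disjoint[OF _ _ disj] finite_page_sets sum_page_sets weights(1)
        del: sum.insert)
  finally have w0: "?w ((\<union>) {} ` (?Q - (?V \<union> ?W))) = (x\<^sup>2 + 2 * x) ^ n - 2 * x ^ n" .
  have notin: "U1 \<notin> P" "U2 \<notin> P" if "P \<in> page_sets T n" for P T
    using that by (auto simp: page_sets_def)
  have "finite (pverts (book_graph n))"
    by (simp add: book_graph_def)
  then have "poly (domination_poly (book_graph n)) x = ?w ((\<union>) {} ` (?Q - (?V \<union> ?W)))
      + ?w ((\<union>) {U1} ` ?Q) + ?w ((\<union>) {U2} ` ?Q) + ?w ((\<union>) {U1, U2} ` page_sets UNIV n)"
    unfolding poly_domination_poly[OF \<open>finite _\<close>] dominating_sets_book_graph
    by (subst sum.union_disjoint; (auto simp: finite_page_sets dest: notin; fail)?)+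
  also have "?w ((\<union>) {U1} ` ?Q) = x * (x\<^sup>2 + 2 * x) ^ n"
    by (subst sum_page_sets_Un) (simp_all add: weights(1) del: sum.insert)
  also have "?w ((\<union>) {U2} ` ?Q) = x * (x\<^sup>2 + 2 * x) ^ n"
    by (subst sum_page_sets_Un) (simp_all add: weights(1) del: sum.insert)
  also have "?w ((\<union>) {U1, U2} ` page_sets UNIV n) = x\<^sup>2 * ((x + 1)\<^sup>2) ^ n"
    by (subst sum_page_sets_Un) (simp_all add: weights(2) power2_eq_square)
  finally show ?thesis
    unfolding w0 by (simp add: algebra_simps)
qed

section \<open>Roots of sums of three powers\<close>

text \<open>Phrasing local conditions as holding for all small radii lets several of them be
  combined before one radius is picked.\<close>

lemma eventually_ball_cball:
  fixes z :: "'a::metric_space"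
  assumes "\<forall>\<^sub>F x in nhds z. P x"
  shows "\<forall>\<^sub>F r in at_right 0. \<forall>x\<in>cball z r. P x"
proof -
  obtain d where d: "d > 0" "\<And>x. dist x z < d \<Longrightarrow> P x"
    using assms by (auto simp: eventually_nhds_metric)
  show ?thesis
    using d by (auto simp: eventually_at_right_field dist_commute intro!: exI[of _ d])
qed

text \<open>Near \<open>z\<close> the quotient stays below a fixed \<open>q < 1\<close> and
  \<open>c\<close> stays bounded, so a geometric sequence bounds the term uniformly.\<close>

lemma uniform_limit_mult_power_quotient:
  fixes c k l :: "complex \<Rightarrow> complex"
  assumes "isCont c z" "isCont k z" "isCont l z" "cmod (k z) < cmod (l z)"
  shows "\<forall>\<^sub>F r in at_right 0.
    uniform_limit (cball z r) (\<lambda>n x. c x * (k x / l x) ^ n) (\<lambda>_. 0) sequentially"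
proof -
  have lz: "l z \<noteq> 0"
    using assms(4) by auto
  then have "cmod (k z / l z) < 1"
    using assms(4) by (simp add: norm_divide)
  then obtain q where q: "cmod (k z / l z) < q" "q < 1"
    using dense by blast
  then have "q > 0"
    by (meson norm_ge_zero order_le_less_trans)
  have "((\<lambda>x. cmod (k x / l x)) \<longlongrightarrow> cmod (k z / l z)) (nhds z)"
    using assms(2,3) lz by (auto intro!: tendsto_intros simp: tendsto_nhds_iff isCont_def)
  then have ev1: "\<forall>\<^sub>F x in nhds z. cmod (k x / l x) < q"
    using q(1) by (rule order_tendstoD)
  have "((\<lambda>x. cmod (c x)) \<longlongrightarrow> cmod (c z)) (nhds z)"
    using assms(1) by (auto intro!: tendsto_intros simp: tendsto_nhds_iff isCont_def)
  then have "\<forall>\<^sub>F x in nhds z. cmod (c x) < cmod (c z) + 1"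
    by (rule order_tendstoD) simp
  with ev1 have "\<forall>\<^sub>F x in nhds z. cmod (k x / l x) < q \<and> cmod (c x) < cmod (c z) + 1"
    by eventually_elim auto
  from eventually_ball_cball[OF this] show ?thesis
  proof eventually_elim
    case (elim r)
    have lim: "(\<lambda>n. (cmod (c z) + 1) * q ^ n) \<longlonglongrightarrow> 0"
      using \<open>q > 0\<close> q by (intro tendsto_mult_right_zero LIMSEQ_realpow_zero) auto
    show ?case
    proof (rule uniform_limitI)
      fix e :: real
      assume "e > 0"
      have "\<forall>\<^sub>F n in sequentially. (cmod (c z) + 1) * q ^ n < e"
        using order_tendstoD(2)[OF lim \<open>e > 0\<close>] .
      then show "\<forall>\<^sub>F n in sequentially. \<forall>x\<in>cball z r. dist (c x * (k x / l x) ^ n) 0 < e"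
      proof eventually_elim
        case (elim n)
        show ?case
        proof
          fix x
          assume "x \<in> cball z r"
          with \<open>\<forall>x\<in>cball z r. _ x\<close> have "cmod (c x) \<le> cmod (c z) + 1" "cmod (k x / l x) \<le> q"
            by (meson less_imp_le)+
          then have "cmod (c x) * cmod (k x / l x) ^ n \<le> (cmod (c z) + 1) * q ^ n"
            by (intro mult_mono power_mono) auto
          then show "dist (c x * (k x / l x) ^ n) 0 < e"
            using elim by (simp add: norm_mult norm_power)
        qed
      qed
    qed
  qed
qed

lemma uniform_limit_subdominant_terms:
  fixes c k c' k' l :: "complex \<Rightarrow> complex"
  assumes "isCont c z" "isCont k z" "isCont c' z" "isCont k' z" "isCont l z"
    and "cmod (k z) < cmod (l z)" "cmod (k' z) < cmod (l z)"
  shows "\<forall>\<^sub>F r in at_right 0. uniform_limit (cball z r)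
    (\<lambda>n x. c x * (k x / l x) ^ n + c' x * (k' x / l x) ^ n) (\<lambda>_. 0) sequentially"
  using uniform_limit_mult_power_quotient[OF assms(1,2,5,6)]
    uniform_limit_mult_power_quotient[OF assms(3,4,5,7)]
proof eventually_elim
  case (elim r)
  from uniform_limit_add[OF this] show ?case
    by simp
qed

lemma eventually_isCont_nonzero:
  fixes f :: "complex \<Rightarrow> complex"
  assumes "isCont f z" "f z \<noteq> 0"
  shows "\<forall>\<^sub>F x in nhds z. f x \<noteq> 0"
  using assms by (auto simp: eventually_nhds_conv_at isCont_def intro: tendsto_imp_eventually_ne)

section \<open>Points where one base dominates\<close>

text \<open>Dividing by \<open>l1 x ^ n\<close> leaves \<open>a1 x\<close> plus a uniformly small
  term, while \<open>cmod (a1 x)\<close> stays above half its value at \<open>z\<close>.\<close>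

lemma dominant_term_no_roots_near:
  fixes a1 a2 a3 l1 l2 l3 :: "complex \<Rightarrow> complex"
  assumes cont: "isCont a1 z" "isCont a2 z" "isCont a3 z" "isCont l1 z" "isCont l2 z" "isCont l3 z"
    and dom: "cmod (l2 z) < cmod (l1 z)" "cmod (l3 z) < cmod (l1 z)"
    and a1: "a1 z \<noteq> 0"
  obtains r where "r > 0"
    "\<forall>\<^sub>F n in sequentially. \<forall>x\<in>cball z r. a1 x * l1 x ^ n + a2 x * l2 x ^ n + a3 x * l3 x ^ n \<noteq> 0"
proof -
  have "l1 z \<noteq> 0"
    using dom by auto
  have lim: "((\<lambda>x. cmod (a1 x)) \<longlongrightarrow> cmod (a1 z)) (nhds z)"
    using cont(1) by (auto intro!: tendsto_intros simp: tendsto_nhds_iff isCont_def)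
  have "\<forall>\<^sub>F x in nhds z. cmod (a1 x) > cmod (a1 z) / 2"
    by (rule order_tendstoD(1)[OF lim]) (use a1 in simp)
  then have "\<forall>\<^sub>F x in nhds z. cmod (a1 x) > cmod (a1 z) / 2 \<and> l1 x \<noteq> 0"
    using eventually_isCont_nonzero[OF cont(4) \<open>l1 z \<noteq> 0\<close>] by eventually_elim auto
  note eventually_ball_cball[OF this]
  moreover have "\<forall>\<^sub>F r in at_right (0::real). r > 0"
    by (rule eventually_at_right_less)
  moreover note uniform_limit_subdominant_terms[OF cont(2,5,3,6,4) dom]
  ultimately have "\<forall>\<^sub>F r in at_right 0. r > 0 \<and>
      (\<forall>x\<in>cball z r. cmod (a1 x) > cmod (a1 z) / 2 \<and> l1 x \<noteq> 0) \<and>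
      uniform_limit (cball z r) (\<lambda>n x. a2 x * (l2 x / l1 x) ^ n + a3 x * (l3 x / l1 x) ^ n)
        (\<lambda>_. 0) sequentially"
    by eventually_elim auto
  from eventually_happens'[OF trivial_limit_at_right_real this]
  obtain r where r: "r > 0" "\<forall>x\<in>cball z r. cmod (a1 x) > cmod (a1 z) / 2 \<and> l1 x \<noteq> 0"
      "uniform_limit (cball z r) (\<lambda>n x. a2 x * (l2 x / l1 x) ^ n + a3 x * (l3 x / l1 x) ^ n)
        (\<lambda>_. 0) sequentially"
    by blast
  have "\<forall>\<^sub>F n in sequentially. \<forall>x\<in>cball z r.
      dist (a2 x * (l2 x / l1 x) ^ n + a3 x * (l3 x / l1 x) ^ n) 0 < cmod (a1 z) / 2"
    using r(3) a1 by (intro uniform_limitD) auto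
  then have "\<forall>\<^sub>F n in sequentially. \<forall>x\<in>cball z r.
      a1 x * l1 x ^ n + a2 x * l2 x ^ n + a3 x * l3 x ^ n \<noteq> 0"
  proof eventually_elim
    case (elim n)
    show ?case
    proof
      fix x
      assume x: "x \<in> cball z r"
      let ?s = "a2 x * (l2 x / l1 x) ^ n + a3 x * (l3 x / l1 x) ^ n"
      have "cmod (- ?s) < cmod (a1 x)"
        using bspec[OF elim x] bspec[OF r(2) x] unfolding norm_minus_cancel dist_norm diff_0_right
        by linarith
      then have "a1 x + ?s \<noteq> 0"
        by (metis add_eq_0_iff2 less_irrefl)
      moreover have "a1 x * l1 x ^ n + a2 x * l2 x ^ n + a3 x * l3 x ^ n = l1 x ^ n * (a1 x + ?s)"
        using x r(2) by (simp add: field_simps)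
      ultimately show "a1 x * l1 x ^ n + a2 x * l2 x ^ n + a3 x * l3 x ^ n \<noteq> 0"
        using x r(2) by simp
    qed
  qed
  with r(1) show ?thesis
    by (rule that)
qed

text \<open>A simple zero of the dominant coefficient attracts roots: after division by
  \<open>l1 x ^ n\<close> the equation reads \<open>x = z - s x / c\<close> with \<open>s\<close>
  uniformly small, and Brouwer's theorem gives a fixed point.\<close>

lemma dominant_term_linear_root_near:
  fixes a2 a3 l1 l2 l3 :: "complex \<Rightarrow> complex"
  assumes cont: "continuous_on UNIV a2" "continuous_on UNIV a3" "continuous_on UNIV l1"
      "continuous_on UNIV l2" "continuous_on UNIV l3"
    and dom: "cmod (l2 z) < cmod (l1 z)" "cmod (l3 z) < cmod (l1 z)"
    and "c \<noteq> 0" "e > 0"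
  shows "\<forall>\<^sub>F n in sequentially. \<exists>x\<in>ball z e.
    c * (x - z) * l1 x ^ n + a2 x * l2 x ^ n + a3 x * l3 x ^ n = 0"
proof -
  have isCont: "isCont a2 z" "isCont a3 z" "isCont l1 z" "isCont l2 z" "isCont l3 z"
    using cont by (simp_all add: continuous_on_eq_continuous_at)
  have "l1 z \<noteq> 0"
    using dom by auto
  have "\<forall>\<^sub>F r in at_right (0::real). 0 < r \<and> r < e"
    using \<open>e > 0\<close> by (auto simp: eventually_at_right_field)
  moreover note eventually_ball_cball[OF eventually_isCont_nonzero[OF isCont(3) \<open>l1 z \<noteq> 0\<close>]]
  moreover note uniform_limit_subdominant_terms[OF isCont(1,4,2,5,3) dom]
  ultimately have "\<forall>\<^sub>F r in at_right 0. 0 < r \<and> r < e \<and> (\<forall>x\<in>cball z r. l1 x \<noteq> 0) \<and>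
      uniform_limit (cball z r) (\<lambda>n x. a2 x * (l2 x / l1 x) ^ n + a3 x * (l3 x / l1 x) ^ n)
        (\<lambda>_. 0) sequentially"
    by eventually_elim auto
  from eventually_happens'[OF trivial_limit_at_right_real this]
  obtain r where r: "0 < r" "r < e" "\<forall>x\<in>cball z r. l1 x \<noteq> 0"
      "uniform_limit (cball z r) (\<lambda>n x. a2 x * (l2 x / l1 x) ^ n + a3 x * (l3 x / l1 x) ^ n)
        (\<lambda>_. 0) sequentially"
    by blast
  \<comment> \<open>The bound \<open>cmod c * r\<close> is exactly what keeps the fixed-point map
    inside \<open>cball z r\<close>.\<close>
  have "\<forall>\<^sub>F n in sequentially. \<forall>x\<in>cball z r.
      dist (a2 x * (l2 x / l1 x) ^ n + a3 x * (l3 x / l1 x) ^ n) 0 < cmod c * r"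
    using r(1,4) \<open>c \<noteq> 0\<close> by (intro uniform_limitD) auto
  then show ?thesis
  proof eventually_elim
    case (elim n)
    let ?s = "\<lambda>x. a2 x * (l2 x / l1 x) ^ n + a3 x * (l3 x / l1 x) ^ n"
    have "continuous_on (cball z r) (\<lambda>x. z - ?s x / c)"
      using r(3) \<open>c \<noteq> 0\<close> by (intro continuous_intros continuous_on_subset[OF cont(1)]
          continuous_on_subset[OF cont(2)] continuous_on_subset[OF cont(3)]
          continuous_on_subset[OF cont(4)] continuous_on_subset[OF cont(5)]) auto
    moreover have "(\<lambda>x. z - ?s x / c) \<in> cball z r \<rightarrow> cball z r"
    proof
      fix x
      assume "x \<in> cball z r"
      then have "cmod (?s x) < cmod c * r"
        using elim by simp
      then show "z - ?s x / c \<in> cball z r"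
        using \<open>c \<noteq> 0\<close> by (simp add: dist_norm norm_divide field_simps)
    qed
    ultimately obtain x where x: "x \<in> cball z r" "z - ?s x / c = x"
      using brouwer[of "cball z r"] r(1) by auto
    then have "c * (x - z) + ?s x = 0"
      using \<open>c \<noteq> 0\<close> by (auto simp: field_simps)
    moreover have "c * (x - z) * l1 x ^ n + a2 x * l2 x ^ n + a3 x * l3 x ^ n =
        l1 x ^ n * (c * (x - z) + ?s x)"
      using x(1) r(3) by (simp add: field_simps)
    ultimately show ?case
      using x(1) r(2) by (intro bexI[of _ x]) auto
  qed
qed

section \<open>Points where two bases dominate with equal modulus\<close>

text \<open>
  With a local logarithm \<open>L\<close> of \<open>F\<close>, the equation reads \<open>n * L x = ln (h n x) + 2 \<pi> i k\<close>.
  In the coordinate \<open>w = L x\<close> it is a fixed-point problem whose right-hand side, divided by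
  \<open>n\<close>, stays within \<open>O(1/n)\<close> of \<open>L z\<close> for a suitable integer \<open>k\<close>, because \<open>L z\<close> is purely
  imaginary.
\<close>

lemma power_eq_solution_near:
  fixes F b :: "complex \<Rightarrow> complex" and h :: "nat \<Rightarrow> complex \<Rightarrow> complex"
  assumes F: "F holomorphic_on S" "open S" "z \<in> S" "cmod (F z) = 1" "deriv F z \<noteq> 0"
    and h: "\<And>n. continuous_on S (h n)" "uniform_limit S h b sequentially"
    and b: "b z \<noteq> 0"
    and e: "e > 0"
  shows "\<forall>\<^sub>F n in sequentially. \<exists>x\<in>S \<inter> ball z e. F x ^ n = h n x"
proof -
  have Fz: "F z \<noteq> 0"
    using F(4) by auto
  have "continuous_on S b"
    by (rule uniform_limit_theorem[OF _ h(2)]) (use h(1) in auto)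
  then have "isCont b z" "isCont F z"
    using F holomorphic_on_imp_continuous_on[OF F(1)]
    by (auto simp: continuous_on_eq_continuous_at)
  then have "(b \<longlongrightarrow> b z) (nhds z)" "(F \<longlongrightarrow> F z) (nhds z)"
    by (simp_all add: tendsto_nhds_iff isCont_def)
  \<comment> \<open>This \<open>1 / 4\<close> and the later \<open>cmod (b z) / 4\<close> add up to
    the \<open>1 / 2\<close> of \<open>near\<close>, the range where \<open>norm_Ln_le\<close>
    applies.\<close>
  from tendstoD[OF tendsto_divide[OF this(1) tendsto_const b], of "1 / 4"]
    tendstoD[OF tendsto_divide[OF this(2) tendsto_const Fz], of 1]
  have "\<forall>\<^sub>F x in nhds z. dist (b x / b z) 1 < 1 / 4" "\<forall>\<^sub>F x in nhds z. dist (F x / F z) 1 < 1"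
    using b Fz by simp_all
  moreover have "\<forall>\<^sub>F x in nhds z. x \<in> S"
    using F by (simp add: eventually_nhds_in_open)
  moreover have "\<forall>\<^sub>F x in nhds z. dist x z < e"
    using e by (auto simp: eventually_nhds_metric)
  ultimately have "\<forall>\<^sub>F x in nhds z. x \<in> S \<and> dist x z < e \<and>
      dist (b x / b z) 1 < 1 / 4 \<and> dist (F x / F z) 1 < 1"
    by eventually_elim auto
  then obtain r where r: "r > 0" "\<And>x. x \<in> ball z r \<Longrightarrow>
      x \<in> S \<and> dist x z < e \<and> dist (b x / b z) 1 < 1 / 4 \<and> dist (F x / F z) 1 < 1"
    by (auto simp: eventually_nhds_metric dist_commute)

  \<comment> \<open>Dividing by \<open>F z\<close> moves the argument near \<open>1\<close>, away
    from the branch cut; adding \<open>Ln (F z)\<close> restores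
    \<open>exp (L x) = F x\<close>.\<close>
  define L where "L = (\<lambda>x. Ln (F x / F z) + Ln (F z))"
  have nonpos: "y \<notin> \<real>\<^sub>\<le>\<^sub>0" if "dist y 1 < 1" for y :: complex
  proof -
    have "\<bar>Re (y - 1)\<bar> < 1"
      using that abs_Re_le_cmod[of "y - 1"] by (simp add: dist_norm)
    then show ?thesis
      by (auto simp: complex_nonpos_Reals_iff)
  qed
  have "L holomorphic_on ball z r"
    unfolding L_def using r(2) Fz nonpos
    by (intro holomorphic_intros holomorphic_on_subset[OF F(1)]) auto
  have "(F has_field_derivative deriv F z) (at z)"
    using F by (simp add: holomorphic_derivI)
  then have "(L has_field_derivative deriv F z / F z) (at z)"
    unfolding L_def using Fz by (auto intro!: derivative_eq_intros simp: field_simps)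
  then have "deriv L z \<noteq> 0"
    using F(5) Fz by (simp add: DERIV_imp_deriv)
  then obtain r' where r': "r' > 0" "ball z r' \<subseteq> ball z r"
      "open (L ` ball z r')" "inj_on L (ball z r')"
    using has_complex_derivative_locally_invertible[OF \<open>L holomorphic_on ball z r\<close>] r(1)
    by (metis centre_in_ball open_ball)
  obtain g where g: "g holomorphic_on L ` ball z r'" "\<And>x. x \<in> ball z r' \<Longrightarrow> g (L x) = x"
    using holomorphic_has_inverse[OF holomorphic_on_subset[OF \<open>L holomorphic_on ball z r\<close> r'(2)]
        open_ball r'(4)] by metis
  define w where "w = Ln (F z)"
  have "L z = w"
    using Fz by (simp add: L_def w_def)
  have "Re w = 0"
    using F(4) Fz by (simp add: w_def)
  obtain d where d: "d > 0" "cball w d \<subseteq> L ` ball z r'"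
    using r'(1,3) \<open>L z = w\<close> open_contains_cball by (metis centre_in_ball image_eqI)
  have g': "g v \<in> ball z r'" "L (g v) = v" if "v \<in> cball w d" for v
    using that d(2) g(2) by (metis (no_types, lifting) imageE subsetD)+

  \<comment> \<open>The summands bound the three errors in \<open>n * (T v - w)\<close>: the
    logarithm of a number near \<open>1\<close>, the constant \<open>Ln (b z)\<close>, and the
    rounding in \<open>k\<close>.\<close>
  define C where "C = 1 + cmod (Ln (b z)) + 2 * pi"
  have "\<forall>\<^sub>F n in sequentially. C / real n < d"
    using order_tendstoD(2)[OF lim_const_over_n[of C] d(1)] .
  moreover have "\<forall>\<^sub>F n in sequentially. \<forall>x\<in>S. dist (h n x) (b x) < cmod (b z) / 4"
    using h(2) b by (intro uniform_limitD) auto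
  ultimately show ?thesis
    using eventually_gt_at_top[of 0]
  proof eventually_elim
    case (elim n)
    \<comment> \<open>Among the branches of the logarithm, this one brings \<open>2 * pi * k\<close>
      within \<open>2 * pi\<close> of \<open>n * Im w\<close>.\<close>
    define k where "k = \<lfloor>real n * Im w / (2 * pi)\<rfloor>"
    define T where "T = (\<lambda>v.
      (Ln (h n (g v) / b z) + Ln (b z) + \<i> * of_real (2 * pi * of_int k)) / of_nat n)"
    have near: "dist (h n (g v) / b z) 1 < 1 / 2" if "v \<in> cball w d" for v
    proof -
      have gv: "g v \<in> ball z r"
        using g'(1)[OF that] r'(2) by blast
      then have "dist (h n (g v)) (b (g v)) < cmod (b z) / 4"
        using elim(2) r(2) by blast
      then have "dist (h n (g v)) (b (g v)) / cmod (b z) < 1 / 4"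
        using b by (simp add: divide_simps)
      moreover have "dist (h n (g v) / b z) (b (g v) / b z) = dist (h n (g v)) (b (g v)) / cmod (b z)"
        by (simp add: dist_norm norm_divide diff_divide_distrib[symmetric])
      ultimately have "dist (h n (g v) / b z) (b (g v) / b z) < 1 / 4"
        by simp
      moreover have "dist (b (g v) / b z) 1 < 1 / 4"
        using gv r(2) by blast
      ultimately show ?thesis
        using dist_triangle[of "h n (g v) / b z" 1 "b (g v) / b z"] by linarith
    qed
    have "continuous_on (cball w d) g"
      using g(1) d(2) holomorphic_on_imp_continuous_on continuous_on_subset by blast
    then have "continuous_on (cball w d) (\<lambda>v. h n (g v))"
      using g'(1) r'(2) r(2) by (intro continuous_on_compose2[OF h(1)]) blast+
    then have "continuous_on (cball w d) T"
      unfolding T_def using b elim(3) near nonpos by (intro continuous_intros) force+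
    moreover have "T \<in> cball w d \<rightarrow> cball w d"
    proof
      fix v
      assume v: "v \<in> cball w d"
      let ?u = "h n (g v) / b z"
      have "cmod (Ln (1 + (?u - 1))) \<le> 2 * cmod (?u - 1)"
        using near[OF v] by (intro norm_Ln_le) (simp add: dist_norm)
      then have 1: "cmod (Ln ?u) \<le> 1"
        using near[OF v] by (simp add: dist_norm)
      have "\<bar>of_int k - real n * Im w / (2 * pi)\<bar> \<le> 1"
        unfolding k_def by linarith
      then have "\<bar>of_int k - real n * Im w / (2 * pi)\<bar> * (2 * pi) \<le> 1 * (2 * pi)"
        by (intro mult_right_mono) auto
      also have "\<bar>of_int k - real n * Im w / (2 * pi)\<bar> * (2 * pi) =
          \<bar>(of_int k - real n * Im w / (2 * pi)) * (2 * pi)\<bar>"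
        by (simp add: abs_mult)
      also have "(of_int k - real n * Im w / (2 * pi)) * (2 * pi) = 2 * pi * of_int k - real n * Im w"
        by (simp add: field_simps)
      finally have 2: "\<bar>2 * pi * of_int k - real n * Im w\<bar> \<le> 2 * pi"
        by simp
      have "w = \<i> * of_real (Im w)"
        using \<open>Re w = 0\<close> by (simp add: complex_eq_iff)
      then have "of_nat n * w = \<i> * of_real (real n * Im w)"
        by (metis mult.left_commute of_real_mult of_real_of_nat_eq)
      then have "w * of_nat n = \<i> * of_real (real n * Im w)"
        by (simp only: mult.commute)
      moreover have "T v * of_nat n = Ln ?u + Ln (b z) + \<i> * of_real (2 * pi * of_int k)"
        using elim(3) by (simp add: T_def)
      ultimately have "(T v - w) * of_nat n =
          Ln ?u + Ln (b z) + \<i> * of_real (2 * pi * of_int k - real n * Im w)"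
        by (simp only: left_diff_distrib of_real_diff right_diff_distrib add_diff_eq)
      then have "cmod (T v - w) * real n =
          cmod (Ln ?u + Ln (b z) + \<i> * of_real (2 * pi * of_int k - real n * Im w))"
        by (metis norm_mult norm_of_nat)
      also have "\<dots> \<le> cmod (Ln ?u) + cmod (Ln (b z)) +
          cmod (\<i> * of_real (2 * pi * of_int k - real n * Im w))"
        by (intro order_trans[OF norm_triangle_ineq] add_right_mono norm_triangle_ineq)
      also have "\<dots> \<le> C"
        unfolding C_def norm_mult norm_ii norm_of_real mult_1 by (intro add_mono 1 2 order_refl)
      finally have "cmod (T v - w) \<le> C / real n"
        using elim(3) by (simp add: field_simps)
      then show "T v \<in> cball w d"
        using elim(1) by (simp add: dist_norm norm_minus_commute)
    qed
    ultimately obtain v where v: "v \<in> cball w d" "T v = v"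
      using brouwer[of "cball w d" T] d(1) by auto
    define x where "x = g v"
    have x: "x \<in> ball z r" "L x = v"
      using g'[OF v(1)] r'(2) by (auto simp: x_def)
    have "F x / F z \<noteq> 0"
      using r(2)[OF x(1)] by auto
    then have "exp (L x) = F x"
      using Fz by (simp add: L_def exp_add)
    then have "F x ^ n = exp (of_nat n * v)"
      using x(2) by (simp add: exp_of_nat_mult)
    also have "of_nat n * v = Ln (h n x / b z) + Ln (b z) + \<i> * of_real (2 * pi * of_int k)"
      using v(2) elim(3) by (auto simp: T_def x_def field_simps)
    also have "exp \<dots> = h n x / b z * b z * 1"
    proof -
      have "h n x / b z \<noteq> 0"
        using near[OF v(1)] by (auto simp: x_def)
      moreover have "exp (\<i> * of_real (2 * pi * of_int k)) = 1"
        using exp_integer_2pi[of "of_int k"] by (simp add: mult_ac)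
      ultimately show ?thesis
        using b by (simp only: exp_add exp_Ln not_False_eq_True)
    qed
    finally have "F x ^ n = h n x"
      using b by simp
    then show ?case
      using r(2)[OF x(1)] by (intro bexI[of _ x]) (auto simp: dist_commute)
  qed
qed

text \<open>Dividing by \<open>a1 x * l2 x ^ n\<close> gives \<open>F x ^ n = h n x\<close> with
  \<open>F = l1 / l2\<close> and \<open>h n\<close> tending uniformly to \<open>- a2 / a1\<close>.
  The Wronskian is the numerator of the derivative of \<open>F\<close>.\<close>

lemma equimodular_roots_near:
  fixes a1 a2 a3 l1 l2 l3 :: "complex \<Rightarrow> complex"
  assumes hol: "l1 holomorphic_on UNIV" "l2 holomorphic_on UNIV"
    and cont: "continuous_on UNIV a1" "continuous_on UNIV a2" "continuous_on UNIV a3"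
      "continuous_on UNIV l3"
    and eq: "cmod (l1 z) = cmod (l2 z)" and dom: "cmod (l3 z) < cmod (l2 z)"
    and nz: "a1 z \<noteq> 0" "a2 z \<noteq> 0"
    and wronskian: "deriv l1 z * l2 z - l1 z * deriv l2 z \<noteq> 0"
    and "e > 0"
  shows "\<forall>\<^sub>F n in sequentially. \<exists>x\<in>ball z e.
    a1 x * l1 x ^ n + a2 x * l2 x ^ n + a3 x * l3 x ^ n = 0"
proof -
  have "continuous_on UNIV l2"
    using hol by (simp add: holomorphic_on_imp_continuous_on)
  have isCont: "isCont a1 z" "isCont a2 z" "isCont a3 z" "isCont l2 z" "isCont l3 z"
    using cont \<open>continuous_on UNIV l2\<close> by (simp_all add: continuous_on_eq_continuous_at)
  have l2z: "l2 z \<noteq> 0"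
    using dom by auto
  have "isCont (\<lambda>x. - a3 x / a1 x) z"
    using isCont nz by simp
  note ev1 = uniform_limit_mult_power_quotient[OF this isCont(5,4) dom]
  have "\<forall>\<^sub>F x in nhds z. a1 x \<noteq> 0 \<and> l2 x \<noteq> 0"
    using eventually_isCont_nonzero[OF isCont(1) nz(1)] eventually_isCont_nonzero[OF isCont(4) l2z]
    by eventually_elim auto
  from ev1 eventually_ball_cball[OF this] eventually_at_right_less[of 0]
  have "\<forall>\<^sub>F r in at_right 0. r > 0 \<and> (\<forall>x\<in>cball z r. a1 x \<noteq> 0 \<and> l2 x \<noteq> 0) \<and>
      uniform_limit (cball z r) (\<lambda>n x. - a3 x / a1 x * (l3 x / l2 x) ^ n) (\<lambda>_. 0) sequentially"
    by eventually_elim auto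
  from eventually_happens'[OF trivial_limit_at_right_real this]
  obtain r where r: "r > 0" "\<forall>x\<in>cball z r. a1 x \<noteq> 0 \<and> l2 x \<noteq> 0"
      "uniform_limit (cball z r) (\<lambda>n x. - a3 x / a1 x * (l3 x / l2 x) ^ n) (\<lambda>_. 0) sequentially"
    by blast
  let ?F = "\<lambda>x. l1 x / l2 x"
  let ?h = "\<lambda>n x. - a2 x / a1 x + (- a3 x / a1 x * (l3 x / l2 x) ^ n)"
  have "\<forall>\<^sub>F n in sequentially. \<exists>x\<in>ball z r \<inter> ball z e. ?F x ^ n = ?h n x"
  proof (rule power_eq_solution_near)
    show "?F holomorphic_on ball z r"
      using r(2) by (intro holomorphic_intros holomorphic_on_subset[OF hol(1)]
          holomorphic_on_subset[OF hol(2)]) auto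
    show "cmod (l1 z / l2 z) = 1"
      using eq l2z by (simp add: norm_divide)
    have "(l1 has_field_derivative deriv l1 z) (at z)" "(l2 has_field_derivative deriv l2 z) (at z)"
      using hol by (auto intro: holomorphic_derivI)
    then have "(?F has_field_derivative (deriv l1 z * l2 z - l1 z * deriv l2 z) / (l2 z * l2 z)) (at z)"
      using l2z by (rule DERIV_divide)
    then show "deriv ?F z \<noteq> 0"
      using wronskian l2z by (simp add: DERIV_imp_deriv)
    show "continuous_on (ball z r) (?h n)" for n
      using r(2) by (intro continuous_intros continuous_on_subset[OF cont(1)]
          continuous_on_subset[OF cont(2)] continuous_on_subset[OF cont(3)]
          continuous_on_subset[OF cont(4)] continuous_on_subset[OF \<open>continuous_on UNIV l2\<close>]) auto
    have "uniform_limit (ball z r) (\<lambda>n x. - a3 x / a1 x * (l3 x / l2 x) ^ n) (\<lambda>_. 0) sequentially"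
      using r(3) by (rule uniform_limit_on_subset) auto
    then show "uniform_limit (ball z r) ?h (\<lambda>x. - a2 x / a1 x + 0) sequentially"
      by (intro uniform_limit_add uniform_limit_const)
    show "- a2 z / a1 z + 0 \<noteq> 0"
      using nz by simp
  qed (use r(1) \<open>e > 0\<close> in auto)
  then show ?thesis
  proof eventually_elim
    case (elim n)
    then obtain x where x: "x \<in> ball z r" "x \<in> ball z e" "?F x ^ n = ?h n x"
      by blast
    have nzx: "a1 x \<noteq> 0" "l2 x \<noteq> 0"
      using x(1) r(2) by auto
    have "a1 x * l1 x ^ n + a2 x * l2 x ^ n + a3 x * l3 x ^ n =
        a1 x * l2 x ^ n * (?F x ^ n - ?h n x)"
      using nzx by (simp add: field_simps)
    then show ?case
      using x by auto
  qed
qed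

section \<open>Accumulation along arcs\<close>

text \<open>Interior parameters tending to \<open>t\<close> give, by injectivity, points of the
  closure other than \<open>\<gamma> t\<close>. Endpoints, where all three moduli may agree, are
  thus covered without a root argument there.\<close>

lemma arc_islimpt:
  fixes \<gamma> :: "real \<Rightarrow> complex"
  assumes "a < b" "continuous_on {a..b} \<gamma>" "inj_on \<gamma> {a..b}" "t \<in> {a..b}"
    and "\<And>s. a < s \<Longrightarrow> s < b \<Longrightarrow> \<gamma> s \<in> closure R"
  shows "\<gamma> t islimpt R"
proof -
  have "t islimpt {a<..<b}"
  proof (cases "t \<in> {a<..<b}")
    case True
    then show ?thesis
      by (intro interior_limit_point) (simp add: interior_open)
  next
    case False
    then show ?thesis
      using assms(1,4) islimpt_greaterThanLessThan1 islimpt_greaterThanLessThan2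
      by (auto simp: order.order_iff_strict)
  qed
  then obtain s where s: "\<And>n. s n \<in> {a<..<b} - {t}" "s \<longlonglongrightarrow> t"
    unfolding islimpt_sequential by blast
  have "(\<lambda>n. \<gamma> (s n)) \<longlonglongrightarrow> \<gamma> t"
    using s assms(4) by (intro continuous_on_tendsto_compose[OF assms(2)]) (auto simp: less_imp_le)
  moreover have "\<gamma> (s n) \<in> closure R - {\<gamma> t}" for n
    using s(1)[of n] assms(4,5) inj_onD[OF assms(3), of "s n" t] by auto
  ultimately have "\<gamma> t islimpt closure R"
    unfolding islimpt_sequential by (intro exI[of _ "\<lambda>n. \<gamma> (s n)"]) auto
  then show ?thesis
    by (simp add: limpt_of_closure)
qed

text \<open>All three arcs have the form \<open>y^2 = D t\<close>; parametrising by the real part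
  makes injectivity automatic.\<close>

lemma sqrt_graph_islimpt:
  fixes D :: "real \<Rightarrow> real" and z :: complex
  assumes "a < b" "Re z \<in> {a..b}" "(Im z)\<^sup>2 = D (Re z)" "continuous_on {a..b} D"
    and D: "\<And>t. a < t \<Longrightarrow> t < b \<Longrightarrow> D t \<ge> 0"
    and R: "\<And>t y. a < t \<Longrightarrow> t < b \<Longrightarrow> y\<^sup>2 = D t \<Longrightarrow> Complex t y \<in> closure R"
  shows "z islimpt R"
proof -
  \<comment> \<open>The sign selects the upper or lower branch through \<open>z\<close>.\<close>
  define s :: real where "s = (if Im z \<ge> 0 then 1 else - 1)"
  define \<gamma> where "\<gamma> = (\<lambda>t. Complex t (s * sqrt (D t)))"
  have "Im z = s * sqrt (D (Re z))"
    using assms(3)[symmetric] by (simp add: s_def)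
  then have z: "z = \<gamma> (Re z)"
    by (simp add: \<gamma>_def complex_eq_iff)
  have "\<gamma> (Re z) islimpt R"
  proof (rule arc_islimpt[OF assms(1) _ _ assms(2)])
    show "continuous_on {a..b} \<gamma>"
      unfolding \<gamma>_def Complex_eq using assms(4) by (intro continuous_intros)
    show "inj_on \<gamma> {a..b}"
      by (auto simp: \<gamma>_def inj_on_def)
    fix t
    assume t: "a < t" "t < b"
    then have "(s * sqrt (D t))\<^sup>2 = D t"
      using D by (simp add: s_def power_mult_distrib)
    with R[OF t] show "\<gamma> t \<in> closure R"
      unfolding \<gamma>_def .
  qed
  with z show ?thesis
    by simp
qed

section \<open>The equimodular arcs\<close>

definition book_roots :: "complex set" where
  "book_roots = (\<Union>n\<in>{1..}. {w. poly (domination_poly (book_graph n)) w = 0})"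

lemma in_closure_book_roots:
  assumes "\<And>e. e > 0 \<Longrightarrow> \<forall>\<^sub>F n in sequentially. \<exists>x\<in>ball z e.
    (2 * x + 1) * (x\<^sup>2 + 2 * x) ^ n + x\<^sup>2 * ((x + 1)\<^sup>2) ^ n + (- 2) * x ^ n = 0"
  shows "z \<in> closure book_roots"
  unfolding closure_approachable
proof (intro allI impI)
  fix e :: real
  assume "e > 0"
  from eventually_conj[OF assms[OF this] eventually_ge_at_top[of 1]]
  obtain n x where "n \<ge> 1" "x \<in> ball z e"
      "(2 * x + 1) * (x\<^sup>2 + 2 * x) ^ n + x\<^sup>2 * ((x + 1)\<^sup>2) ^ n + (- 2) * x ^ n = 0"
    by (auto simp: eventually_sequentially)
  then show "\<exists>y\<in>book_roots. dist y z < e"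
    by (intro bexI[of _ x])
      (auto simp: book_roots_def poly_domination_poly_book_graph dist_commute)
qed

lemma two_mult_plus_one_eq_0_iff: "2 * z + 1 = 0 \<longleftrightarrow> z = - 1 / 2" for z :: complex
proof -
  have "2 * z + 1 = 2 * (z - (- 1 / 2))"
    by simp
  then show ?thesis
    by (metis mult_eq_0_iff right_minus_eq zero_neq_numeral)
qed

lemma deriv_book_bases:
  "deriv (\<lambda>x. x\<^sup>2 + 2 * x) (z :: complex) = 2 * z + 2"
  "deriv (\<lambda>x. (x + 1)\<^sup>2) (z :: complex) = 2 * (z + 1)"
  by (auto intro!: DERIV_imp_deriv derivative_eq_intros)

text \<open>Since \<open>x^2 + 2 * x = x * (x + 2)\<close>, this base and \<open>x\<close> are
  equimodular on the circle; their Wronskian is \<open>z^2\<close>.\<close>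

lemma circle_in_closure_book_roots:
  assumes "cmod (z + 2) = 1" "(cmod (z + 1))\<^sup>2 < cmod z"
  shows "z \<in> closure book_roots"
proof (rule in_closure_book_roots)
  fix e :: real
  assume "e > 0"
  have "z \<noteq> 0"
    using assms(2) by auto
  have "z \<noteq> - 1 / 2"
    using assms(1) by auto
  then have "2 * z + 1 \<noteq> 0"
    by (simp add: two_mult_plus_one_eq_0_iff)
  have "\<forall>\<^sub>F n in sequentially. \<exists>x\<in>ball z e.
      (2 * x + 1) * (x\<^sup>2 + 2 * x) ^ n + (- 2) * x ^ n + x\<^sup>2 * ((x + 1)\<^sup>2) ^ n = 0"
  proof (rule equimodular_roots_near)
    have "z\<^sup>2 + 2 * z = z * (z + 2)"
      by (simp add: power2_eq_square algebra_simps)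
    then show "cmod (z\<^sup>2 + 2 * z) = cmod z"
      using assms(1) by (simp add: norm_mult)
    have eq: "(2 * z + 2) * z - (z\<^sup>2 + 2 * z) * 1 = z\<^sup>2"
      by (simp add: power2_eq_square algebra_simps)
    show "deriv (\<lambda>x. x\<^sup>2 + 2 * x) z * z - (z\<^sup>2 + 2 * z) * deriv (\<lambda>x. x) z \<noteq> 0"
      unfolding deriv_book_bases deriv_ident eq using \<open>z \<noteq> 0\<close> by simp
  qed (use assms(2) \<open>2 * z + 1 \<noteq> 0\<close> \<open>e > 0\<close> in
      \<open>auto intro!: holomorphic_intros continuous_intros simp: norm_power\<close>)
  then show "\<forall>\<^sub>F n in sequentially. \<exists>x\<in>ball z e.
      (2 * x + 1) * (x\<^sup>2 + 2 * x) ^ n + x\<^sup>2 * ((x + 1)\<^sup>2) ^ n + (- 2) * x ^ n = 0"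
    by eventually_elim (simp only: add_ac)
qed

text \<open>The bases \<open>x^2 + 2 * x\<close> and \<open>(x + 1)^2\<close> differ by
  \<open>1\<close>, so their Wronskian is just \<open>2 * (z + 1)\<close>.\<close>

lemma hyperbola_in_closure_book_roots:
  assumes "cmod (z\<^sup>2 + 2 * z) = (cmod (z + 1))\<^sup>2" "cmod z < (cmod (z + 1))\<^sup>2"
  shows "z \<in> closure book_roots"
proof (rule in_closure_book_roots)
  fix e :: real
  assume "e > 0"
  have "z \<noteq> 0" "z + 1 \<noteq> 0"
    using assms by auto
  \<comment> \<open>At \<open>- 1 / 2\<close> the strict hypothesis would read
    \<open>1 / 2 < 1 / 4\<close>.\<close>
  have "z \<noteq> - 1 / 2"
    using assms(2) by (auto simp: power2_eq_square)
  then have "2 * z + 1 \<noteq> 0"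
    by (simp add: two_mult_plus_one_eq_0_iff)
  show "\<forall>\<^sub>F n in sequentially. \<exists>x\<in>ball z e.
      (2 * x + 1) * (x\<^sup>2 + 2 * x) ^ n + x\<^sup>2 * ((x + 1)\<^sup>2) ^ n + (- 2) * x ^ n = 0"
  proof (rule equimodular_roots_near)
    have eq: "(2 * z + 2) * (z + 1)\<^sup>2 - (z\<^sup>2 + 2 * z) * (2 * (z + 1)) = 2 * (z + 1)"
      by (simp add: power2_eq_square algebra_simps)
    show "deriv (\<lambda>x. x\<^sup>2 + 2 * x) z * (z + 1)\<^sup>2 -
        (z\<^sup>2 + 2 * z) * deriv (\<lambda>x. (x + 1)\<^sup>2) z \<noteq> 0"
      unfolding deriv_book_bases eq using \<open>z + 1 \<noteq> 0\<close> by (metis mult_eq_0_iff zero_neq_numeral)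
  qed (use assms \<open>2 * z + 1 \<noteq> 0\<close> \<open>z \<noteq> 0\<close> \<open>e > 0\<close> in
      \<open>auto intro!: holomorphic_intros continuous_intros simp: norm_power\<close>)
qed

text \<open>Here \<open>(x + 1)^2\<close> and \<open>x\<close> are the dominant pair, with Wronskian
  \<open>(z + 1) * (z - 1)\<close>.\<close>

lemma curve_in_closure_book_roots:
  assumes "(cmod (z + 1))\<^sup>2 = cmod z" "cmod (z\<^sup>2 + 2 * z) < cmod z"
  shows "z \<in> closure book_roots"
proof (rule in_closure_book_roots)
  fix e :: real
  assume "e > 0"
  \<comment> \<open>The two sides of the curve equation are \<open>1\<close> and \<open>0\<close> at
    \<open>0\<close>, \<open>0\<close> and \<open>1\<close> at \<open>- 1\<close>, and
    \<open>4\<close> and \<open>1\<close> at \<open>1\<close>.\<close>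
  have "z \<noteq> 0" "z \<noteq> - 1" "z \<noteq> 1"
    using assms by auto
  have "\<forall>\<^sub>F n in sequentially. \<exists>x\<in>ball z e.
      x\<^sup>2 * ((x + 1)\<^sup>2) ^ n + (- 2) * x ^ n + (2 * x + 1) * (x\<^sup>2 + 2 * x) ^ n = 0"
  proof (rule equimodular_roots_near)
    have "2 * (z + 1) * z - (z + 1)\<^sup>2 * 1 = (z + 1) * (z - 1)"
      by (simp add: power2_eq_square algebra_simps)
    moreover have "(z + 1) * (z - 1) \<noteq> 0"
      using \<open>z \<noteq> - 1\<close> \<open>z \<noteq> 1\<close> by (simp add: add_eq_0_iff2)
    ultimately show "deriv (\<lambda>x. (x + 1)\<^sup>2) z * z - (z + 1)\<^sup>2 * deriv (\<lambda>x. x) z \<noteq> 0"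
      by (simp add: deriv_book_bases)
  qed (use assms \<open>z \<noteq> 0\<close> \<open>e > 0\<close> in
      \<open>auto intro!: holomorphic_intros continuous_intros simp: norm_power\<close>)
  then show "\<forall>\<^sub>F n in sequentially. \<exists>x\<in>ball z e.
      (2 * x + 1) * (x\<^sup>2 + 2 * x) ^ n + x\<^sup>2 * ((x + 1)\<^sup>2) ^ n + (- 2) * x ^ n = 0"
    by eventually_elim (simp only: add_ac)
qed

section \<open>Comparing moduli through real parts\<close>

lemma cmod_square: "(cmod z)\<^sup>2 = (Re z)\<^sup>2 + (Im z)\<^sup>2"
  by (simp add: cmod_def)

lemma cmod_base: "cmod (z\<^sup>2 + 2 * z) = cmod z * cmod (z + 2)"
  by (simp add: norm_mult[symmetric] power2_eq_square algebra_simps)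

text \<open>On the circle both squared moduli are linear in \<open>Re z\<close>, so the comparison
  becomes a quadratic inequality in \<open>Re z\<close>. The strict form serves to find roots, the
  weak one to exclude points off the arcs.\<close>

lemma circle_real_part:
  assumes "cmod (z + 2) = 1"
  shows "(cmod (z + 1))\<^sup>2 < cmod z \<longleftrightarrow> Re z > - 3 / 2 - sqrt 2 / 2"
    and "(cmod (z + 1))\<^sup>2 \<le> cmod z \<longleftrightarrow> Re z \<ge> - 3 / 2 - sqrt 2 / 2"
proof -
  have "(cmod (z + 2))\<^sup>2 = 1"
    using assms by simp
  then have eq: "(Re z + 2)\<^sup>2 + (Im z)\<^sup>2 = 1"
    by (simp add: cmod_square)
  then have "(Re z + 2)\<^sup>2 \<le> 1\<^sup>2"
    using zero_le_power2[of "Im z"] by (simp only: power_one)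
  then have Re: "Re z \<le> - 1"
    using abs_le_square_iff[of "Re z + 2" 1] by simp
  have sq: "(cmod z)\<^sup>2 = - 4 * Re z - 3" "(cmod (z + 1))\<^sup>2 = - 2 * Re z - 2"
    using eq unfolding cmod_square by (simp_all add: power2_eq_square algebra_simps)
  \<comment> \<open>This factor belongs to the other root of the quadratic; it is positive because
    \<open>Re z \<le> - 1\<close> on the circle.\<close>
  let ?p = "sqrt 2 / 2 - 3 / 2 - Re z"
  have "sqrt 2 > 1"
    by simp
  then have "?p > 0"
    using Re by linarith
  have "(cmod z)\<^sup>2 - ((cmod (z + 1))\<^sup>2)\<^sup>2 = 4 * ((Re z - (- 3 / 2 - sqrt 2 / 2)) * ?p)"
    unfolding sq by (simp add: power2_eq_square field_simps)
  moreover have "0 \<le> 4 * ((Re z - (- 3 / 2 - sqrt 2 / 2)) * ?p) \<longleftrightarrow> Re z \<ge> - 3 / 2 - sqrt 2 / 2"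
    "0 < 4 * ((Re z - (- 3 / 2 - sqrt 2 / 2)) * ?p) \<longleftrightarrow> Re z > - 3 / 2 - sqrt 2 / 2"
    using \<open>?p > 0\<close> by (simp_all only: zero_le_mult_iff zero_less_mult_iff) auto
  moreover have "(cmod (z + 1))\<^sup>2 \<le> cmod z \<longleftrightarrow> ((cmod (z + 1))\<^sup>2)\<^sup>2 \<le> (cmod z)\<^sup>2"
    "cmod z \<le> (cmod (z + 1))\<^sup>2 \<longleftrightarrow> (cmod z)\<^sup>2 \<le> ((cmod (z + 1))\<^sup>2)\<^sup>2"
    by (rule power_mono_iff[symmetric]; simp)+
  ultimately show "(cmod (z + 1))\<^sup>2 < cmod z \<longleftrightarrow> Re z > - 3 / 2 - sqrt 2 / 2"
    "(cmod (z + 1))\<^sup>2 \<le> cmod z \<longleftrightarrow> Re z \<ge> - 3 / 2 - sqrt 2 / 2"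
    by linarith+
qed

text \<open>With \<open>u = Re ((z + 1)^2)\<close>, the two bases have real parts
  \<open>u - 1\<close> and \<open>u\<close> and the same imaginary part, so equal moduli mean
  \<open>u = 1 / 2\<close>.\<close>

lemma hyperbola_iff:
  "cmod (z\<^sup>2 + 2 * z) = (cmod (z + 1))\<^sup>2 \<longleftrightarrow> (Re z + 1)\<^sup>2 - (Im z)\<^sup>2 = 1 / 2"
proof -
  define u where "u = (Re z + 1)\<^sup>2 - (Im z)\<^sup>2"
  have "cmod (z\<^sup>2 + 2 * z) = (cmod (z + 1))\<^sup>2 \<longleftrightarrow>
      (cmod (z\<^sup>2 + 2 * z))\<^sup>2 = ((cmod (z + 1))\<^sup>2)\<^sup>2"
    by (rule power2_eq_iff_nonneg[symmetric]) simp_all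
  also have "(cmod (z\<^sup>2 + 2 * z))\<^sup>2 = (u - 1)\<^sup>2 + (2 * (Re z + 1) * Im z)\<^sup>2"
    unfolding cmod_square u_def by (simp add: Re_power2 Im_power2 power2_eq_square algebra_simps)
  also have "((cmod (z + 1))\<^sup>2)\<^sup>2 = u\<^sup>2 + (2 * (Re z + 1) * Im z)\<^sup>2"
    unfolding cmod_square u_def by (simp add: power2_eq_square algebra_simps)
  also have "(u - 1)\<^sup>2 + (2 * (Re z + 1) * Im z)\<^sup>2 =
      u\<^sup>2 + (2 * (Re z + 1) * Im z)\<^sup>2 \<longleftrightarrow> u = 1 / 2"
    by (auto simp: power2_eq_square algebra_simps)
  finally show ?thesis
    unfolding u_def .
qed

text \<open>On the hyperbola \<open>(cmod (z + 2))^2 = (2 * Re z + 3)^2 / 2\<close>. Together with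
  \<open>\<bar>Re z + 1\<bar> \<ge> sqrt 2 / 2\<close> this confines
  \<open>cmod (z + 2) \<le> 1\<close> to a piece of the left branch.\<close>

lemma hyperbola_real_part:
  assumes "(Re z + 1)\<^sup>2 - (Im z)\<^sup>2 = 1 / 2"
  shows "cmod (z + 2) > 1 \<longleftrightarrow> Re z \<notin> {(- 3 - sqrt 2) / 2..(- 2 - sqrt 2) / 2}"
proof -
  have "cmod (z + 2) \<le> 1 \<longleftrightarrow> (cmod (z + 2))\<^sup>2 \<le> 1\<^sup>2"
    by (rule power_mono_iff[symmetric]) auto
  also have "(cmod (z + 2))\<^sup>2 = (2 * Re z + 3)\<^sup>2 / 2"
    using assms unfolding cmod_square by (simp add: power2_eq_square field_simps)
  also have "(2 * Re z + 3)\<^sup>2 / 2 \<le> 1\<^sup>2 \<longleftrightarrow> \<bar>2 * Re z + 3\<bar> \<le> sqrt 2"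
    using abs_le_square_iff[of "2 * Re z + 3" "sqrt 2"] by simp
  finally have iff: "cmod (z + 2) \<le> 1 \<longleftrightarrow> \<bar>2 * Re z + 3\<bar> \<le> sqrt 2" .
  have "sqrt 2 / 2 \<le> \<bar>Re z + 1\<bar>"
    using abs_le_square_iff[of "sqrt 2 / 2" "Re z + 1"] assms zero_le_power2[of "Im z"]
    by (simp add: power_divide)
  moreover have "sqrt 2 > 1"
    by simp
  moreover have "\<bar>2 * x + 3\<bar> \<le> s \<longleftrightarrow> x \<in> {(- 3 - s) / 2..(- 2 - s) / 2}"
    if "s / 2 \<le> \<bar>x + 1\<bar>" "s > 1" for s x :: real
    using that by (auto simp: abs_if split: if_splits)
  ultimately have "\<bar>2 * Re z + 3\<bar> \<le> sqrt 2 \<longleftrightarrow> Re z \<in> {(- 3 - sqrt 2) / 2..(- 2 - sqrt 2) / 2}"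
    by blast
  with iff show ?thesis
    by (simp only: not_le[symmetric])
qed

text \<open>In terms of \<open>r = cmod z\<close>, both differences have the sign of
  \<open>r - (1 + sqrt 2)\<close>: the remaining factors are positive.\<close>

lemma curve_real_part:
  assumes "(cmod (z + 1))\<^sup>2 = cmod z"
  shows "cmod (z + 2) < 1 \<longleftrightarrow> Re z < - 3 / 2 - sqrt 2 / 2"
    and "cmod (z + 2) \<le> 1 \<longleftrightarrow> Re z \<le> - 3 / 2 - sqrt 2 / 2"
proof -
  define r where "r = cmod z"
  have "r \<ge> 0"
    by (simp add: r_def)
  have r2: "r\<^sup>2 = (Re z)\<^sup>2 + (Im z)\<^sup>2"
    by (simp add: r_def cmod_square)
  have "r\<^sup>2 + 2 * Re z + 1 = r"
    using assms unfolding r_def[symmetric] r2 cmod_square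
    by (simp add: power2_eq_square algebra_simps)
  then have Re: "Re z = (r - r\<^sup>2 - 1) / 2"
    by simp
  have "(cmod (z + 2))\<^sup>2 = r\<^sup>2 + 4 * Re z + 4"
    unfolding r2 cmod_square by (simp add: power2_eq_square algebra_simps)
  also have "4 * Re z = 2 * r - 2 * r\<^sup>2 - 2"
    using Re by simp
  finally have "1 - (cmod (z + 2))\<^sup>2 = (r - (1 + sqrt 2)) * (r + (sqrt 2 - 1))"
    by (simp add: algebra_simps) (simp add: power2_eq_square)
  moreover have "(- 3 / 2 - sqrt 2 / 2) - Re z = (r - (1 + sqrt 2)) * (r + sqrt 2) / 2"
    unfolding Re by (simp add: power2_eq_square field_simps)
  moreover have "r + (sqrt 2 - 1) > 0" "r + sqrt 2 > 0"
    using \<open>r \<ge> 0\<close> by (simp_all add: add_nonneg_pos)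
  then have "0 < (r - (1 + sqrt 2)) * (r + (sqrt 2 - 1)) \<longleftrightarrow>
      0 < (r - (1 + sqrt 2)) * (r + sqrt 2) / 2"
    "0 \<le> (r - (1 + sqrt 2)) * (r + (sqrt 2 - 1)) \<longleftrightarrow>
      0 \<le> (r - (1 + sqrt 2)) * (r + sqrt 2) / 2"
    by (simp_all add: zero_less_mult_iff zero_le_mult_iff)
  moreover have "cmod (z + 2) \<le> 1 \<longleftrightarrow> (cmod (z + 2))\<^sup>2 \<le> 1"
    "1 \<le> cmod (z + 2) \<longleftrightarrow> 1 \<le> (cmod (z + 2))\<^sup>2"
    using power_mono_iff[of "cmod (z + 2)" 1 2] power_mono_iff[of 1 "cmod (z + 2)" 2] by auto
  ultimately show "cmod (z + 2) < 1 \<longleftrightarrow> Re z < - 3 / 2 - sqrt 2 / 2"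
    "cmod (z + 2) \<le> 1 \<longleftrightarrow> Re z \<le> - 3 / 2 - sqrt 2 / 2"
    by linarith+
qed

section \<open>Every point of the arcs is a limit point\<close>

lemma circle_islimpt_book_roots:
  assumes "cmod (z + 2) = 1" "Re z \<ge> - 3 / 2 - sqrt 2 / 2"
  shows "z islimpt book_roots"
proof (rule sqrt_graph_islimpt)
  let ?D = "\<lambda>t. 1 - (t + 2)\<^sup>2 :: real"
  have circ: "cmod (Complex t y + 2) = 1 \<longleftrightarrow> y\<^sup>2 = ?D t" for t y
    by (simp add: cmod_def) argo
  show "(Im z)\<^sup>2 = ?D (Re z)"
    using circ[of "Re z" "Im z"] assms(1) by simp
  then have "(Re z + 2)\<^sup>2 \<le> 1"
    using zero_le_power2[of "Im z"] by linarith
  then show "Re z \<in> {- 3 / 2 - sqrt 2 / 2..- 1}"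
    using abs_le_square_iff[of "Re z + 2" 1] assms(2) by simp
  show "- 3 / 2 - sqrt 2 / 2 < (- 1 :: real)"
    using real_sqrt_ge_zero[of 2] by linarith
  show "continuous_on {- 3 / 2 - sqrt 2 / 2..- 1} ?D"
    by (intro continuous_intros)
  fix t :: real
  assume t: "- 3 / 2 - sqrt 2 / 2 < t" "t < - 1"
  \<comment> \<open>This puts \<open>t\<close> to the right of \<open>- 3\<close>, the leftmost real
    part on the circle.\<close>
  have "sqrt 2 < 2"
    by (simp add: real_less_lsqrt)
  with t have "\<bar>t + 2\<bar> \<le> 1"
    by linarith
  then show "0 \<le> ?D t"
    using abs_le_square_iff[of "t + 2" 1] by simp
  fix y
  assume "y\<^sup>2 = ?D t"
  then have "cmod (Complex t y + 2) = 1"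
    by (simp add: circ)
  then show "Complex t y \<in> closure book_roots"
    using circle_in_closure_book_roots circle_real_part(1) t(1) by simp
qed

text \<open>Removing a closed interval leaves only points with \<open>cmod (z + 2) > 1\<close>,
  where exactly two bases dominate. Since the arcs are unbounded, a bounded window of parameters
  around \<open>Re z\<close> is used.\<close>

lemma hyperbola_islimpt_book_roots:
  assumes "(Re z + 1)\<^sup>2 - (Im z)\<^sup>2 = 1 / 2"
    and "Re z \<notin> {(- 3 - sqrt 2) / 2..(- 2 - sqrt 2) / 2}"
  shows "z islimpt book_roots"
proof -
  have generic: "Complex t y \<in> closure book_roots"
    if "y\<^sup>2 = (t + 1)\<^sup>2 - 1 / 2" "t \<notin> {(- 3 - sqrt 2) / 2..(- 2 - sqrt 2) / 2}" for t y
  proof (rule hyperbola_in_closure_book_roots)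
    let ?w = "Complex t y"
    have hyp: "(Re ?w + 1)\<^sup>2 - (Im ?w)\<^sup>2 = 1 / 2"
      unfolding complex.sel using that(1) by linarith
    then show eq: "cmod (?w\<^sup>2 + 2 * ?w) = (cmod (?w + 1))\<^sup>2"
      by (simp only: hyperbola_iff)
    have "cmod (?w + 2) > 1"
      using hyperbola_real_part[OF hyp] that(2) by simp
    moreover have "?w \<noteq> 0"
      using eq by force
    ultimately have "cmod ?w < cmod (?w\<^sup>2 + 2 * ?w)"
      unfolding cmod_base by simp
    with eq show "cmod ?w < (cmod (?w + 1))\<^sup>2"
      by simp
  qed
  have "sqrt 2 > 1"
    by simp
  have half: "(t + 1)\<^sup>2 \<ge> 1 / 2 \<longleftrightarrow> \<bar>t + 1\<bar> \<ge> sqrt 2 / 2" for t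
    using abs_le_square_iff[of "sqrt 2 / 2" "t + 1"] by (simp add: power_divide)
  have "(Re z + 1)\<^sup>2 \<ge> 1 / 2"
    using assms(1) zero_le_power2[of "Im z"] by linarith
  then have "\<bar>Re z + 1\<bar> \<ge> sqrt 2 / 2"
    by (simp only: half)
  \<comment> \<open>The left branch ends at the right end of the excluded interval, so only its part
    beyond the left end survives.\<close>
  then have "Re z + 1 \<ge> sqrt 2 / 2 \<or> Re z < (- 3 - sqrt 2) / 2"
    using assms(2) by (cases "Re z + 1 \<ge> 0") auto
  then consider "Re z + 1 \<ge> sqrt 2 / 2" | "Re z < (- 3 - sqrt 2) / 2"
    by blast
  then show ?thesis
  proof cases
    case 1
    show ?thesis
    proof (rule sqrt_graph_islimpt[where a = "sqrt 2 / 2 - 1" and b = "Re z + 1"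
          and D = "\<lambda>t. (t + 1)\<^sup>2 - 1 / 2"])
      fix t y :: real
      assume t: "sqrt 2 / 2 - 1 < t" "t < Re z + 1"
      then have "\<bar>t + 1\<bar> \<ge> sqrt 2 / 2"
        by linarith
      then show "0 \<le> (t + 1)\<^sup>2 - 1 / 2"
        unfolding half[symmetric] by simp
      have "(- 2 - sqrt 2) / 2 = - 1 - sqrt 2 / 2" "sqrt 2 / 2 > 0"
        by simp_all
      with t(1) have "(- 2 - sqrt 2) / 2 < t"
        by linarith
      then have "t \<notin> {(- 3 - sqrt 2) / 2..(- 2 - sqrt 2) / 2}"
        by simp
      moreover assume "y\<^sup>2 = (t + 1)\<^sup>2 - 1 / 2"
      ultimately show "Complex t y \<in> closure book_roots"
        by (intro generic)
    qed (use 1 assms(1) in \<open>auto intro!: continuous_intros\<close>)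
  next
    case 2
    show ?thesis
    proof (rule sqrt_graph_islimpt[where a = "Re z - 1" and b = "(- 3 - sqrt 2) / 2"
          and D = "\<lambda>t. (t + 1)\<^sup>2 - 1 / 2"])
      fix t y :: real
      assume t: "Re z - 1 < t" "t < (- 3 - sqrt 2) / 2"
      then have "sqrt 2 / 2 \<le> - (t + 1)"
        by simp
      then have "\<bar>t + 1\<bar> \<ge> sqrt 2 / 2"
        by linarith
      then show "0 \<le> (t + 1)\<^sup>2 - 1 / 2"
        unfolding half[symmetric] by simp
      assume "y\<^sup>2 = (t + 1)\<^sup>2 - 1 / 2"
      then show "Complex t y \<in> closure book_roots"
        using t by (intro generic) auto
    qed (use 2 assms(1) in \<open>auto intro!: continuous_intros\<close>)
  qed
qed

text \<open>
  On the curve, \<open>r = cmod z\<close> satisfies \<open>r\<^sup>2 - r + 1 + 2 * Re z = 0\<close>, so \<open>r\<close> is the larger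
  root of this quadratic; the leftmost point of the curve is where \<open>r = - Re z\<close>.
\<close>

lemma curve_islimpt_book_roots:
  assumes "(cmod (z + 1))\<^sup>2 = cmod z" "Re z \<le> - 3 / 2 - sqrt 2 / 2"
  shows "z islimpt book_roots"
proof (rule sqrt_graph_islimpt)
  define \<rho> where "\<rho> = (\<lambda>t. (1 + sqrt (- 3 - 8 * t)) / 2)"
  let ?D = "\<lambda>t. (\<rho> t)\<^sup>2 - t\<^sup>2"
  \<comment> \<open>At the leftmost point, \<open>r = - Re z\<close> turns the curve equation into
    \<open>r^2 - 3 * r + 1 = 0\<close>, whose larger root is
    \<open>(3 + sqrt 5) / 2\<close>.\<close>
  let ?a = "- 3 / 2 - sqrt 5 / 2" and ?b = "- 3 / 2 - sqrt 2 / 2"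
  have sqrt2: "sqrt 2 > 1"
    by simp
  have \<rho>_eq: "(\<rho> t)\<^sup>2 + 2 * t + 1 = \<rho> t" if "t \<le> ?b" for t
  proof -
    have "- 3 - 8 * t \<ge> 0"
      using that sqrt2 by linarith
    then have "(sqrt (- 3 - 8 * t))\<^sup>2 = - 3 - 8 * t"
      by simp
    then show ?thesis
      by (simp add: \<rho>_def power2_eq_square field_simps)
  qed
  define r where "r = cmod z"
  have "r \<ge> 0"
    by (simp add: r_def)
  have r2: "r\<^sup>2 = (Re z)\<^sup>2 + (Im z)\<^sup>2"
    by (simp add: r_def cmod_square)
  have r_eq: "r\<^sup>2 + 2 * Re z + 1 = r"
    using assms(1) unfolding r_def[symmetric] r2 cmod_square
    by (simp add: power2_eq_square algebra_simps)
  have "\<rho> (Re z) = r"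
  proof -
    have "(2 * r - 1)\<^sup>2 = - 3 - 8 * Re z"
      using r_eq by (simp add: power2_eq_square algebra_simps)
    \<comment> \<open>The product \<open>r * (r - 1)\<close> is positive, so \<open>r > 1\<close>;
      this selects the larger root.\<close>
    moreover have "2 * r - 1 \<ge> 0"
    proof -
      have "r * (r - 1) = - 2 * Re z - 1"
        using r_eq by (simp add: power2_eq_square algebra_simps)
      then have "r * (r - 1) > 0"
        using assms(2) sqrt2 by linarith
      then show ?thesis
        using \<open>r \<ge> 0\<close> by (auto simp: zero_less_mult_iff)
    qed
    ultimately have "sqrt (- 3 - 8 * Re z) = 2 * r - 1"
      by (metis real_sqrt_unique)
    then show ?thesis
      by (simp add: \<rho>_def)
  qed
  then show "(Im z)\<^sup>2 = ?D (Re z)"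
    by (simp add: r2)
  have "Re z \<ge> ?a"
  proof -
    have "- Re z \<le> r"
      using abs_Re_le_cmod[of z] by (simp add: r_def)
    moreover from this have "(r - 3 / 2)\<^sup>2 \<le> (sqrt 5 / 2)\<^sup>2"
      using r_eq by (simp add: power_divide power2_diff)
    then have "\<bar>r - 3 / 2\<bar> \<le> \<bar>sqrt 5 / 2\<bar>"
      by (simp only: abs_le_square_iff)
    ultimately show ?thesis
      using real_sqrt_ge_zero[of 5] by linarith
  qed
  then show "Re z \<in> {?a..?b}"
    using assms(2) by simp
  show "?a < ?b"
    by simp
  show "continuous_on {?a..?b} ?D"
    unfolding \<rho>_def by (intro continuous_intros) auto
  fix t :: real
  assume t: "?a < t" "t < ?b"
  have "t < 0"
    using t sqrt2 by linarith
  \<comment> \<open>Right of the leftmost point the prescribed modulus is at least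
    \<open>\<bar>t\<bar>\<close>, so a real imaginary part exists.\<close>
  have "- t \<le> \<rho> t"
  proof -
    have "\<bar>t + 3 / 2\<bar> \<le> \<bar>sqrt 5 / 2\<bar>"
      using t sqrt2 by linarith
    then have "(t + 3 / 2)\<^sup>2 \<le> (sqrt 5 / 2)\<^sup>2"
      by (simp only: abs_le_square_iff)
    then have "(- 2 * t - 1)\<^sup>2 \<le> - 3 - 8 * t"
      by (simp add: power2_eq_square algebra_simps)
    then have "- 2 * t - 1 \<le> sqrt (- 3 - 8 * t)"
      by (rule real_le_rsqrt)
    then show ?thesis
      by (simp add: \<rho>_def)
  qed
  then show "0 \<le> ?D t"
    using \<open>t < 0\<close> power_mono[of "- t" "\<rho> t" 2] by simp
  fix y
  assume y: "y\<^sup>2 = ?D t"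
  let ?w = "Complex t y"
  have "\<rho> t \<ge> 0"
    using \<open>t < 0\<close> \<open>- t \<le> \<rho> t\<close> by linarith
  with y have w: "cmod ?w = \<rho> t"
    by (simp add: cmod_def)
  have "(cmod (?w + 1))\<^sup>2 = (cmod ?w)\<^sup>2 + 2 * t + 1"
    unfolding cmod_square by (simp add: power2_eq_square algebra_simps)
  also have "\<dots> = cmod ?w"
    unfolding w using \<rho>_eq t by simp
  finally have curve: "(cmod (?w + 1))\<^sup>2 = cmod ?w" .
  then have "cmod (?w + 2) < 1"
    using t curve_real_part(1)[OF curve] by simp
  moreover have "?w \<noteq> 0"
    using \<open>t < 0\<close> by (auto simp: complex_eq_iff)
  ultimately have "cmod (?w\<^sup>2 + 2 * ?w) < cmod ?w"
    unfolding cmod_base by simp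
  with curve show "?w \<in> closure book_roots"
    by (rule curve_in_closure_book_roots)
qed

section \<open>The limits of roots\<close>

text \<open>The moduli of the bases at \<open>- 1 / 2\<close> are \<open>3 / 4\<close>,
  \<open>1 / 4\<close>, \<open>1 / 2\<close>, and the coefficient \<open>2 * x + 1\<close> of the
  first has a simple zero there, so roots come arbitrarily close. As \<open>- 1 / 2\<close> is never
  a root itself, it is a genuine limit point.\<close>

lemma neg_half_islimpt_book_roots: "- 1 / 2 islimpt book_roots"
proof -
  have "- 1 / 2 \<in> closure book_roots"
  proof (rule in_closure_book_roots)
    fix e :: real
    assume "e > 0"
    have "\<forall>\<^sub>F n in sequentially. \<exists>x\<in>ball (- 1 / 2) e.
        2 * (x - - 1 / 2) * (x\<^sup>2 + 2 * x) ^ n + x\<^sup>2 * ((x + 1)\<^sup>2) ^ n + (- 2) * x ^ n = (0 :: complex)"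
      by (rule dominant_term_linear_root_near)
        (use \<open>e > 0\<close> in \<open>auto intro!: continuous_intros simp: power2_eq_square norm_mult\<close>)
    moreover have "2 * (x - - 1 / 2) = 2 * x + 1" for x :: complex
      by simp
    ultimately show "\<forall>\<^sub>F n in sequentially. \<exists>x\<in>ball (- 1 / 2) e.
        (2 * x + 1) * (x\<^sup>2 + 2 * x) ^ n + x\<^sup>2 * ((x + 1)\<^sup>2) ^ n + (- 2) * x ^ n = (0 :: complex)"
      by simp
  qed
  moreover have "- 1 / 2 \<notin> book_roots"
  proof
    assume "- 1 / 2 \<in> book_roots"
    then obtain n where n: "n \<ge> 1" "poly (domination_poly (book_graph n)) (- 1 / 2) = 0"
      by (auto simp: book_roots_def)
    then have "(1 / 4) * (1 / 4) ^ n = 2 * (- 1 / 2 :: complex) ^ n"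
      by (simp add: poly_domination_poly_book_graph power2_eq_square)
    then have "cmod ((1 / 4) * (1 / 4) ^ n) = cmod (2 * (- 1 / 2) ^ n)"
      by (rule arg_cong)
    then have "(1 / 4) * (1 / 4) ^ n = 2 * (1 / 2 :: real) ^ n"
      by (simp add: norm_mult norm_power norm_divide)
    moreover have "(1 / 4) ^ n \<le> (1 / 2 :: real) ^ n"
      by (intro power_mono) auto
    moreover have "(1 / 2 :: real) ^ n > 0"
      by simp
    ultimately show False
      by linarith
  qed
  ultimately show ?thesis
    by (simp add: closure_def)
qed

text \<open>The value at \<open>1\<close>, the number of dominating sets, is positive. Hence each
  polynomial has finitely many roots.\<close>

lemma domination_poly_book_graph_nonzero:
  assumes "n \<ge> 1"
  shows "domination_poly (book_graph n) \<noteq> 0"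
proof
  assume "domination_poly (book_graph n) = 0"
  then have "poly (domination_poly (book_graph n)) 1 = 0"
    by simp
  then have "complex_of_real (3 * 3 ^ n + 4 ^ n - 2) = 0"
    using assms by (simp add: poly_domination_poly_book_graph)
  then have "3 * 3 ^ n + 4 ^ n - (2 :: real) = 0"
    by (simp only: of_real_eq_0_iff)
  moreover have "(3 :: real) ^ n \<ge> 1" "(4 :: real) ^ n \<ge> 1"
    by simp_all
  ultimately show False
    by linarith
qed

text \<open>In a root-free disc for large indices, only finitely many polynomials contribute roots,
  hence only finitely many roots occur.\<close>

lemma not_limit_of_roots:
  assumes nz: "\<And>n. n \<ge> 1 \<Longrightarrow> f n \<noteq> 0"
    and "r > 0" and ev: "\<forall>\<^sub>F n in sequentially. \<forall>x\<in>cball z r. poly (f n) x \<noteq> 0"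
  shows "\<not> limit_of_roots f z"
proof
  assume "limit_of_roots f z"
  then consider "\<forall>\<^sub>F n in sequentially. poly (f n) z = 0"
    | "z islimpt (\<Union>n\<in>{1..}. {w. poly (f n) w = 0})"
    unfolding limit_of_roots_def by blast
  then show False
  proof cases
    case 1
    from eventually_conj[OF 1 ev] show False
      using \<open>r > 0\<close> by (auto simp: eventually_sequentially)
  next
    case 2
    obtain N where N: "\<And>n x. n \<ge> N \<Longrightarrow> x \<in> cball z r \<Longrightarrow> poly (f n) x \<noteq> 0"
      using ev unfolding eventually_sequentially by blast
    have "(\<Union>n\<in>{1..}. {w. poly (f n) w = 0}) \<inter> ball z r \<subseteq> (\<Union>n\<in>{1..<N}. {w. poly (f n) w = 0})"
    proof
      fix x
      assume "x \<in> (\<Union>n\<in>{1..}. {w. poly (f n) w = 0}) \<inter> ball z r"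
      then obtain n where "n \<ge> 1" "poly (f n) x = 0" "x \<in> cball z r"
        by auto
      moreover from this have "n < N"
        using N not_le by blast
      ultimately show "x \<in> (\<Union>n\<in>{1..<N}. {w. poly (f n) w = 0})"
        by auto
    qed
    moreover have "finite (\<Union>n\<in>{1..<N}. {w. poly (f n) w = 0})"
      using nz by (auto intro!: poly_roots_finite)
    ultimately have "finite ((\<Union>n\<in>{1..}. {w. poly (f n) w = 0}) \<inter> ball z r)"
      by (rule finite_subset)
    with 2 \<open>r > 0\<close> show False
      unfolding islimpt_eq_infinite_ball by blast
  qed
qed

text \<open>Leaving the coefficients and bases generic allows any of the three terms to play the
  dominant one.\<close>

lemma dominant_not_limit_of_roots:
  assumes "isCont a1 z" "isCont a2 z" "isCont a3 z" "isCont l1 z" "isCont l2 z" "isCont l3 z"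
    and "cmod (l2 z) < cmod (l1 z)" "cmod (l3 z) < cmod (l1 z)" "a1 z \<noteq> 0"
    and eq: "\<And>n x. n \<ge> 1 \<Longrightarrow> poly (domination_poly (book_graph n)) x =
      a1 x * l1 x ^ n + a2 x * l2 x ^ n + a3 x * l3 x ^ n"
  shows "\<not> limit_of_roots (\<lambda>n. domination_poly (book_graph n)) z"
proof -
  obtain r where r: "r > 0"
    "\<forall>\<^sub>F n in sequentially. \<forall>x\<in>cball z r. a1 x * l1 x ^ n + a2 x * l2 x ^ n + a3 x * l3 x ^ n \<noteq> 0"
    using dominant_term_no_roots_near[OF assms(1-9)] .
  from r(2) eventually_ge_at_top[of 1]
  have "\<forall>\<^sub>F n in sequentially. \<forall>x\<in>cball z r. poly (domination_poly (book_graph n)) x \<noteq> 0"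
    by eventually_elim (simp add: eq)
  with r(1) show ?thesis
    using domination_poly_book_graph_nonzero by (intro not_limit_of_roots)
qed

theorem theorem3p6:
  shows "{z :: complex. limit_of_roots (\<lambda>n. domination_poly (book_graph n)) z} =
    {- 1 / 2, 0}
    \<union> {z. cmod (z + 2) = 1 \<and> Re z \<ge> - 3 / 2 - sqrt 2 / 2}
    \<union> {z. (Re z + 1)\<^sup>2 - (Im z)\<^sup>2 = 1 / 2 \<and>
           Re z \<notin> {(- 3 - sqrt 2) / 2..(- 2 - sqrt 2) / 2}}
    \<union> {z. (cmod (z + 1))\<^sup>2 = cmod z \<and> Re z \<le> - 3 / 2 - sqrt 2 / 2}"
  (is "?L = ?T")
proof
  show "?T \<subseteq> ?L"
  proof
    fix z
    assume "z \<in> ?T"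
    then consider "z = 0" | "z islimpt book_roots"
      using neg_half_islimpt_book_roots circle_islimpt_book_roots hyperbola_islimpt_book_roots
        curve_islimpt_book_roots by blast
    then show "z \<in> ?L"
    proof cases
      case 1
      have "\<forall>\<^sub>F n in sequentially. poly (domination_poly (book_graph n)) 0 = 0"
        using eventually_ge_at_top[of 1]
        by eventually_elim (simp add: poly_domination_poly_book_graph)
      with 1 show ?thesis
        by (simp add: limit_of_roots_def)
    next
      case 2
      then show ?thesis
        by (simp add: limit_of_roots_def book_roots_def)
    qed
  qed
next
  show "?L \<subseteq> ?T"
  proof (rule subsetI, rule ccontr)
    fix z
    assume "z \<in> ?L" "z \<notin> ?T"
    let ?A = "cmod (z\<^sup>2 + 2 * z)" and ?B = "cmod ((z + 1)\<^sup>2)"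
    \<comment> \<open>These keep the coefficients \<open>x^2\<close> and \<open>2 * x + 1\<close>
      nonzero at \<open>z\<close>; the third, \<open>- 2\<close>, never vanishes.\<close>
    have "z \<noteq> 0" "2 * z + 1 \<noteq> 0"
      using \<open>z \<notin> ?T\<close> two_mult_plus_one_eq_0_iff by auto
    have B: "?B = (cmod (z + 1))\<^sup>2"
      by (simp add: norm_power)
    have not_circle: "\<not> (?A = cmod z \<and> ?B \<le> cmod z)"
    proof
      assume asm: "?A = cmod z \<and> ?B \<le> cmod z"
      then have "cmod (z + 2) = 1"
        using \<open>z \<noteq> 0\<close> by (simp add: cmod_base)
      with asm show False
        using circle_real_part(2)[of z] \<open>z \<notin> ?T\<close> unfolding B by blast
    qed
    have not_hyperbola: "\<not> (?A = ?B \<and> cmod z \<le> ?A)"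
    proof
      assume asm: "?A = ?B \<and> cmod z \<le> ?A"
      then have hyp: "(Re z + 1)\<^sup>2 - (Im z)\<^sup>2 = 1 / 2"
        unfolding B hyperbola_iff by blast
      have "cmod (z + 2) \<ge> 1"
        using asm \<open>z \<noteq> 0\<close> by (simp add: cmod_base)
      moreover have "\<not> cmod (z + 2) > 1"
        using hyperbola_real_part[OF hyp] hyp \<open>z \<notin> ?T\<close> by blast
      \<comment> \<open>On the excluded piece of the hyperbola only a triple tie is left, and that
        lies on the closed circular arc.\<close>
      ultimately have "?A = cmod z"
        by (simp add: cmod_base)
      with asm not_circle show False
        by simp
    qed
    have not_curve: "\<not> (?B = cmod z \<and> ?A \<le> cmod z)"
    proof
      assume asm: "?B = cmod z \<and> ?A \<le> cmod z"
      then have "cmod (z + 2) \<le> 1"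
        using \<open>z \<noteq> 0\<close> by (simp add: cmod_base)
      with asm show False
        using curve_real_part(2)[of z] \<open>z \<notin> ?T\<close> unfolding B by blast
    qed
    \<comment> \<open>No two moduli tie for the maximum, so one base strictly dominates.\<close>
    consider "?B < ?A" "cmod z < ?A" | "?A < ?B" "cmod z < ?B" | "?A < cmod z" "?B < cmod z"
      using not_circle not_hyperbola not_curve by argo
    then have "\<not> limit_of_roots (\<lambda>n. domination_poly (book_graph n)) z"
    proof cases
      case 1
      then show ?thesis
        using \<open>2 * z + 1 \<noteq> 0\<close>
        by (intro dominant_not_limit_of_roots[where ?a1.0 = "\<lambda>x. 2 * x + 1"
              and ?l1.0 = "\<lambda>x. x\<^sup>2 + 2 * x"
              and ?a2.0 = "\<lambda>x. x\<^sup>2" and ?l2.0 = "\<lambda>x. (x + 1)\<^sup>2"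
              and ?a3.0 = "\<lambda>_. - 2" and ?l3.0 = "\<lambda>x. x"])
          (auto intro!: continuous_intros simp: poly_domination_poly_book_graph)
    next
      case 2
      then show ?thesis
        using \<open>z \<noteq> 0\<close>
        by (intro dominant_not_limit_of_roots[where ?a2.0 = "\<lambda>x. 2 * x + 1"
              and ?l2.0 = "\<lambda>x. x\<^sup>2 + 2 * x"
              and ?a1.0 = "\<lambda>x. x\<^sup>2" and ?l1.0 = "\<lambda>x. (x + 1)\<^sup>2"
              and ?a3.0 = "\<lambda>_. - 2" and ?l3.0 = "\<lambda>x. x"])
          (auto intro!: continuous_intros simp: poly_domination_poly_book_graph)
    next
      case 3
      then show ?thesis
        by (intro dominant_not_limit_of_roots[where ?a2.0 = "\<lambda>x. 2 * x + 1"
              and ?l2.0 = "\<lambda>x. x\<^sup>2 + 2 * x"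
              and ?a3.0 = "\<lambda>x. x\<^sup>2" and ?l3.0 = "\<lambda>x. (x + 1)\<^sup>2"
              and ?a1.0 = "\<lambda>_. - 2" and ?l1.0 = "\<lambda>x. x"])
          (auto intro!: continuous_intros simp: poly_domination_poly_book_graph)
    qed
    with \<open>z \<in> ?L\<close> show False
      by simp
  qed
qed

end
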